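(* A discrete-time transfer function $G(z)$ is Hankel totally positive if and only if there exists a minimal realization $(A,b,c)$ of $G(z)$ that is internally Hankel totally positive.
   Context: $G(z)=\sum_{t\ge1}g(t)z^{-t}$ is a real rational, strictly proper transfer function whose impulse response $g$ is absolutely summable (with $g(0)=0$). A triple $(A,b,c)$ with $A\in\mathbb{R}^{n\times n}$, $b,c^{\mathsf T}\in\mathbb{R}^n$ is a realization of $G(z)$ if $A$ is stable (all eigenvalues in the open unit disc) and $g(t)=cA^{t-1}b$ for $t\ge1$. It is minimal if the eigenvalues of $A$ (with multiplicity) are precisely the poles of $G(z)$. Variation: for a real vector or sequence $u$, $S(u)$ is the number of sign changes in $u$ after deleting all zero entries, with $S(0)=0$. A linear map $X$ is order-preserving $m$-variation diminishing ($\mathrm{OVD}_m$), $m\ge 0$, if for all $u$ with $S(u)\le m$: (1) $S(Xu)\le S(u)$; and (2) whenever $S(Xu)=S(u)$, the signs of the first nonzero elements of $u$ and $Xu$ coincide (void if $u$ or $Xu$ is zero). Operators. Past inputs $u$ are bounded and ordered as the sequence $(u(-1),u(-2),u(-3),\dots)$. The Hankel operator is $(\mathcal{H}_gu)(t)=\sum_{\tau=1}^\infty g(t+\tau)u(-\tau)$, $t=0,1,2,\dots$. The controllability operator is $\mathcal{C}(A,b)u=\sum_{t=-\infty}^{-1}A^{-t-1}b\,u(t)$, and the observability operator is $(\mathcal{O}(A,c)x_0)(t)=cA^tx_0$ for $x_0\in\mathbb{R}^n$, $t=0,1,2,\dots$. $G(z)$ is Hankel totally positive if $\mathcal{H}_g$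 is $\mathrm{OVD}_{k-1}$ for every $k\ge1$. $(A,b,c)$ is internally Hankel totally positive if $A$, $\mathcal{C}(A,b)$ and $\mathcal{O}(A,c)$ are $\mathrm{OVD}_{k-1}$ for every $k\ge1$. *)

theory Defs
  imports Complex_Main "HOL-Library.Extended_Nat"
    "HOL-Computational_Algebra.Polynomial_Factorial"
    "HOL-Computational_Algebra.Field_as_Ring"
    "Jordan_Normal_Form.Char_Poly"
begin

section \<open>Variation and order-preserving variation diminishing maps\<close>

text \<open>The pairs of positions \<^term>\<open>i < j\<close> below are those that become adjacent once the zero
  entries are deleted, and whose entries have opposite signs.  A sequence may have infinitely
  many sign changes.\<close>

definition sign_change_pairs :: "(nat \<Rightarrow> real) \<Rightarrow> (nat \<times> nat) set" where
  "sign_change_pairs x =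
     {(i, j). i < j \<and> x i * x j < 0 \<and> (\<forall>k. i < k \<and> k < j \<longrightarrow> x k = 0)}"

definition variation :: "(nat \<Rightarrow> real) \<Rightarrow> enat" where
  "variation x =
     (if finite (sign_change_pairs x) then enat (card (sign_change_pairs x)) else \<infinity>)"

definition first_nonzero :: "(nat \<Rightarrow> real) \<Rightarrow> real" where
  "first_nonzero x = x (LEAST i. x i \<noteq> 0)"

text \<open>Inputs and outputs may be vectors, one-sided sequences or past inputs, so the functions
  \<open>\<sigma>\<close> and \<open>\<sigma>'\<close> give the ordered list of entries of an element of the domain \<open>U\<close> and of the
  codomain, respectively.\<close>

definition OVD ::
  "('a \<Rightarrow> nat \<Rightarrow> real) \<Rightarrow> ('b \<Rightarrow> nat \<Rightarrow> real) \<Rightarrow> 'a set \<Rightarrow> nat \<Rightarrow> ('a \<Rightarrow> 'b) \<Rightarrow> bool" where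
  "OVD \<sigma> \<sigma>' U m X \<longleftrightarrow>
     (\<forall>u\<in>U. variation (\<sigma> u) \<le> enat m \<longrightarrow>
        variation (\<sigma>' (X u)) \<le> variation (\<sigma> u) \<and>
        (variation (\<sigma>' (X u)) = variation (\<sigma> u) \<and>
         (\<exists>i. \<sigma> u i \<noteq> 0) \<and> (\<exists>i. \<sigma>' (X u) i \<noteq> 0) \<longrightarrow>
           sgn (first_nonzero (\<sigma> u)) = sgn (first_nonzero (\<sigma>' (X u)))))"

text \<open>Vectors are padded with zeros; since zero entries are deleted, this changes neither the
  variation nor the first nonzero entry.\<close>

definition vec_entries :: "real vec \<Rightarrow> nat \<Rightarrow> real" where
  "vec_entries v i = (if i < dim_vec v then v $ i else 0)"

text \<open>Only the values of \<open>u\<close> at negative times matter; they are listed backwards, as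
  \<open>u(-1), u(-2), \<dots>\<close>.\<close>

definition past_entries :: "(int \<Rightarrow> real) \<Rightarrow> nat \<Rightarrow> real" where
  "past_entries u k = u (- int (Suc k))"

definition past_inputs :: "(int \<Rightarrow> real) set" where
  "past_inputs = {u. Bseq (past_entries u)}"


section \<open>Transfer functions\<close>

text \<open>A real rational function is an element of the fraction field of the real polynomials;
  \<^const>\<open>quot_of_fract\<close> yields its numerator and denominator in lowest terms.\<close>

definition numer :: "real poly fract \<Rightarrow> real poly" where
  "numer G = fst (quot_of_fract G)"

definition denom :: "real poly fract \<Rightarrow> real poly" where
  "denom G = snd (quot_of_fract G)"

definition eval_fract :: "real poly fract \<Rightarrow> complex \<Rightarrow> complex" where
  "eval_fract G z =
     poly (map_poly complex_of_real (numer G)) z / poly (map_poly complex_of_real (denom G)) z"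

text \<open>The order of \<open>z\<close> as a pole of \<open>G\<close>; it is \<open>0\<close> if \<open>z\<close> is not a pole.\<close>

definition pole_order :: "real poly fract \<Rightarrow> complex \<Rightarrow> nat" where
  "pole_order G z = order z (map_poly complex_of_real (denom G))"

definition strictly_proper :: "real poly fract \<Rightarrow> bool" where
  "strictly_proper G \<longleftrightarrow> G = 0 \<or> degree (numer G) < degree (denom G)"

text \<open>Absolute summability makes the series converge outside the closed unit disc, which is
  where it is required to represent \<open>G\<close>.  In particular \<open>G\<close> has no poles there: it stays
  bounded on \<open>|z| \<ge> r\<close> for every \<open>r > 1\<close>, so the convention \<open>x / 0 = 0\<close> is never used.\<close>

definition transfer_function :: "real poly fract \<Rightarrow> (nat \<Rightarrow> real) \<Rightarrow> bool" where
  "transfer_function G g \<longleftrightarrow>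
     strictly_proper G \<and> g 0 = 0 \<and> summable (\<lambda>t. \<bar>g t\<bar>) \<and>
     (\<forall>z. cmod z > 1 \<longrightarrow>
        (\<lambda>t. complex_of_real (g (Suc t)) / z ^ Suc t) sums eval_fract G z)"


section \<open>Realizations\<close>

definition stable :: "real mat \<Rightarrow> bool" where
  "stable A \<longleftrightarrow> (\<forall>z. eigenvalue (map_mat complex_of_real A) z \<longrightarrow> cmod z < 1)"

text \<open>The row vector \<open>c\<close> is represented by its transpose.  The dimension \<open>n = 0\<close> is allowed: it
  is the dimension of a minimal realization of \<open>G = 0\<close>, which has no poles.\<close>

definition realization ::
  "nat \<Rightarrow> real mat \<Rightarrow> real vec \<Rightarrow> real vec \<Rightarrow> (nat \<Rightarrow> real) \<Rightarrow> bool" where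
  "realization n A b c g \<longleftrightarrow>
     A \<in> carrier_mat n n \<and> b \<in> carrier_vec n \<and> c \<in> carrier_vec n \<and> stable A \<and>
     (\<forall>t\<ge>1. g t = c \<bullet> (A ^\<^sub>m (t - 1) *\<^sub>v b))"

definition minimal_realization ::
  "nat \<Rightarrow> real mat \<Rightarrow> real vec \<Rightarrow> real vec \<Rightarrow> real poly fract \<Rightarrow> (nat \<Rightarrow> real) \<Rightarrow> bool" where
  "minimal_realization n A b c G g \<longleftrightarrow>
     realization n A b c g \<and>
     (\<forall>z. order z (char_poly (map_mat complex_of_real A)) = pole_order G z)"


section \<open>Operators and Hankel total positivity\<close>

definition hankel_op :: "(nat \<Rightarrow> real) \<Rightarrow> (int \<Rightarrow> real) \<Rightarrow> nat \<Rightarrow> real" where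
  "hankel_op g u t = (\<Sum>k. g (t + Suc k) * u (- int (Suc k)))"

text \<open>The sum over the times \<open>t \<le> -1\<close> is taken entrywise, with \<open>t = -(k + 1)\<close>.\<close>

definition controllability_op :: "nat \<Rightarrow> real mat \<Rightarrow> real vec \<Rightarrow> (int \<Rightarrow> real) \<Rightarrow> real vec" where
  "controllability_op n A b u =
     vec n (\<lambda>i. \<Sum>k. (A ^\<^sub>m k *\<^sub>v b) $ i * u (- int (Suc k)))"

definition observability_op :: "real mat \<Rightarrow> real vec \<Rightarrow> real vec \<Rightarrow> nat \<Rightarrow> real" where
  "observability_op A c x t = c \<bullet> (A ^\<^sub>m t *\<^sub>v x)"

definition hankel_totally_positive :: "(nat \<Rightarrow> real) \<Rightarrow> bool" where
  "hankel_totally_positive g \<longleftrightarrow>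
     (\<forall>k\<ge>1. OVD past_entries (\<lambda>y. y) past_inputs (k - 1) (hankel_op g))"

definition internally_hankel_totally_positive ::
  "nat \<Rightarrow> real mat \<Rightarrow> real vec \<Rightarrow> real vec \<Rightarrow> bool" where
  "internally_hankel_totally_positive n A b c \<longleftrightarrow>
     (\<forall>k\<ge>1.
        OVD vec_entries vec_entries (carrier_vec n) (k - 1) (\<lambda>x. A *\<^sub>v x) \<and>
        OVD past_entries vec_entries past_inputs (k - 1) (controllability_op n A b) \<and>
        OVD vec_entries (\<lambda>y. y) (carrier_vec n) (k - 1) (observability_op A c))"

end

theory Submission
  imports Defs "HOL-Analysis.Function_Topology" "Jordan_Normal_Form.Spectral_Radius"
begin

text \<open>If \<open>(A, b, c)\<close> is internally Hankel totally positive, then so is \<open>g\<close>, because the Hankel operator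
  is the observability operator composed with the controllability operator.

  Conversely, suppose that \<open>g\<close> is Hankel totally positive.  The symmetric sections of the Hankel
  matrices \<open>(g (i + j + 1))\<close> and \<open>(g (i + j + 2))\<close> have no negative eigenvalue, since a corresponding
  eigenvector would be mapped to a vector with as many sign changes and the opposite leading sign.
  So the functional \<open>L\<close> with \<open>L (x ^ k) = g (k + 1)\<close> satisfies \<open>L (q\<^sup>2) \<ge> 0\<close> and \<open>L (x q\<^sup>2) \<ge> 0\<close>, and its
  radical is the ideal generated by the denominator of \<open>G\<close>.  This forces the poles to be simple, real
  and nonnegative, and \<open>L\<close> to be a sum of point evaluations at the poles with positive weights.  The
  realization with \<open>A\<close> the diagonal matrix of the increasingly ordered poles, \<open>b = (1, \<dots>, 1)\<close> and \<open>c\<close>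
  the weights is then internally Hankel totally positive: for the controllability operator this is
  Descartes' rule of signs for power series, and for the observability operator its analogue for
  sums of exponentials.\<close>

section \<open>Alternating chains and variation\<close>

lemma bounded_chain_mono:
  fixes f :: "nat \<Rightarrow> 'a::linorder"
  assumes "\<forall>j<m. f j < f (Suc j)" "i \<le> j" "j \<le> m"
  shows "f i \<le> f j"
  using assms(2,3)
proof (induction j)
  case (Suc j)
  then show ?case using assms(1)[rule_format, of j] by (cases "i = Suc j") auto
qed simp

text \<open>For nonzero sequences, the largest such \<open>m\<close> is the variation; in contrast to it, this notion records
  the leading sign and makes sense for functions of a real variable.\<close>

definition alternates :: "'a::linorder set \<Rightarrow> real \<Rightarrow> nat \<Rightarrow> ('a \<Rightarrow> real) \<Rightarrow> bool" where
  "alternates D s m x \<longleftrightarrow>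
     (\<exists>f. (\<forall>j\<le>m. f j \<in> D \<and> 0 < s * (-1) ^ j * x (f j)) \<and> (\<forall>j<m. f j < f (Suc j)))"

text \<open>A chain sees only signs and positions, so it survives every change that keeps strictly
  positive and strictly negative entries. Later this removes positive weights, zero padding and
  denominators.\<close>

lemma alternates_mono:
  assumes "alternates D s m x" and "\<And>i. i \<in> D \<Longrightarrow> 0 < x i \<Longrightarrow> i \<in> E \<and> 0 < y i"
    and "\<And>i. i \<in> D \<Longrightarrow> x i < 0 \<Longrightarrow> i \<in> E \<and> y i < 0"
  shows "alternates E s m y"
proof -
  obtain f where f: "\<forall>j\<le>m. f j \<in> D \<and> 0 < s * (-1) ^ j * x (f j)" "\<forall>j<m. f j < f (Suc j)"
    using assms(1) unfolding alternates_def by blast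
  have "f j \<in> E \<and> 0 < s * (-1) ^ j * y (f j)" if "j \<le> m" for j
  proof -
    have "f j \<in> D" "0 < s * (-1) ^ j * x (f j)" using f(1) that by auto
    then show ?thesis
      using assms(2,3)[of "f j"] unfolding zero_less_mult_iff[of "s * (-1) ^ j"] by blast
  qed
  with f(2) show ?thesis unfolding alternates_def by blast
qed

lemma alternates_nonzero:
  assumes "alternates D s m x" shows "\<exists>i. x i \<noteq> 0"
proof -
  obtain f where "\<forall>j\<le>m. 0 < s * (-1) ^ j * x (f j)"
    using assms unfolding alternates_def by blast
  then have "0 < s * x (f 0)" by (metis le0 power_0 mult_1_right)
  then have "x (f 0) \<noteq> 0" by auto
  then show ?thesis ..
qed

lemma alternates_butlast: "alternates D s (Suc m) x \<Longrightarrow> alternates D s m x"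
  unfolding alternates_def by (elim exE, rule_tac x = f in exI) simp

lemma alternates_tl:
  assumes "alternates D s (Suc m) x" shows "alternates D (- s) m x"
proof -
  obtain f where f: "\<forall>j\<le>Suc m. f j \<in> D \<and> 0 < s * (-1) ^ j * x (f j)"
    "\<forall>j<Suc m. f j < f (Suc j)"
    using assms unfolding alternates_def by blast
  have "\<forall>j\<le>m. f (Suc j) \<in> D \<and> 0 < - s * (-1) ^ j * x (f (Suc j))"
    using f(1) by fastforce
  with f(2) show ?thesis unfolding alternates_def by (intro exI[of _ "\<lambda>j. f (Suc j)"]) auto
qed

lemma alternates_Cons:
  assumes f: "\<forall>j\<le>m. f j \<in> D \<and> 0 < - s * (-1) ^ j * x (f j)" "\<forall>j<m. f j < f (Suc j)"
    and i: "i \<in> D" "0 < s * x i" "i < f 0"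
  shows "alternates D s (Suc m) x"
  unfolding alternates_def
proof (intro exI[of _ "case_nat i f"] conjI allI impI)
  fix j assume "j \<le> Suc m"
  then show "case_nat i f j \<in> D" using f(1) i(1) by (cases j) auto
next
  fix j assume "j \<le> Suc m"
  then show "0 < s * (- 1) ^ j * x (case_nat i f j)"
    using f(1) i(2) by (cases j) (auto simp: mult_ac)
next
  fix j assume "j < Suc m"
  then show "case_nat i f j < case_nat i f (Suc j)" using f(2) i(3) by (cases j) auto
qed

text \<open>The two chains start at different points because their leading signs differ. The earlier
  starting point can be put in front of the other chain.\<close>

lemma alternates_both_signs:
  assumes "alternates D s m x" "alternates D (- s) m x"
  shows "alternates D s (Suc m) x \<or> alternates D (- s) (Suc m) x"
proof -
  obtain f where f: "\<forall>j\<le>m. f j \<in> D \<and> 0 < s * (-1) ^ j * x (f j)" "\<forall>j<m. f j < f (Suc j)"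
    using assms(1) unfolding alternates_def by blast
  obtain h where h: "\<forall>j\<le>m. h j \<in> D \<and> 0 < - s * (-1) ^ j * x (h j)" "\<forall>j<m. h j < h (Suc j)"
    using assms(2) unfolding alternates_def by blast
  have f0: "f 0 \<in> D" "0 < s * x (f 0)" and h0: "h 0 \<in> D" "0 < - s * x (h 0)"
    using f(1) h(1) by auto
  then have "f 0 \<noteq> h 0" by auto
  then consider "f 0 < h 0" | "h 0 < f 0" by fastforce
  then show ?thesis
  proof cases
    case 1 with alternates_Cons[OF h f0] show ?thesis by blast
  next
    case 2 with alternates_Cons[of m f D "- s" x "h 0"] f h0 show ?thesis by simp
  qed
qed

text \<open>Take for \<open>b\<close> the first position after \<open>i\<close> whose sign is
  opposite to that of \<open>x i\<close>, and for \<open>a\<close> the last nonzero position before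
  \<open>b\<close>. No entry between \<open>i\<close> and \<open>b\<close> has the opposite sign, so
  \<open>x a\<close> has the sign of \<open>x i\<close>.\<close>

lemma sign_change_between:
  assumes "i < j" "x i * x j < (0::real)"
  obtains a b where "(a, b) \<in> sign_change_pairs x" "i \<le> a" "b \<le> j"
proof -
  define b where "b = (LEAST b. i < b \<and> x i * x b < 0)"
  have b: "i < b \<and> x i * x b < 0" unfolding b_def by (rule LeastI[of _ j]) (use assms in simp)
  have bj: "b \<le> j" unfolding b_def by (rule Least_le) (use assms in simp)
  have b_min: "\<not> x i * x k < 0" if "i < k" "k < b" for k
    using not_less_Least[of k "\<lambda>b. i < b \<and> x i * x b < 0"] that unfolding b_def by auto
  define a where "a = (GREATEST a. a < b \<and> x a \<noteq> 0)"
  have a: "a < b \<and> x a \<noteq> 0" unfolding a_def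
    by (rule GreatestI_nat[of _ i b]) (use b in auto)
  have a_max: "k \<le> a" if "k < b" "x k \<noteq> 0" for k unfolding a_def
    by (rule Greatest_le_nat[of _ k b]) (use that in auto)
  have ia: "i \<le> a" using a_max[of i] b by (cases "x i = 0") auto
  have "x a * x b < 0"
  proof (cases "a = i")
    case False
    then have "\<not> x i * x a < 0" using b_min ia a by simp
    with a b show ?thesis by (auto simp: mult_less_0_iff)
  qed (use b in simp)
  moreover have "x k = 0" if "a < k" "k < b" for k using a_max[of k] that by auto
  ultimately have "(a, b) \<in> sign_change_pairs x" using a unfolding sign_change_pairs_def by auto
  then show ?thesis using ia bj by (rule that)
qed

text \<open>Every step of the chain encloses a sign change of adjacent nonzero entries. The windows
  of different steps meet at most in an end point, so the chosen pairs are distinct.\<close>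

lemma alternates_le_variation:
  assumes "alternates UNIV s m x" shows "enat m \<le> variation x"
proof (cases "finite (sign_change_pairs x)")
  case True
  obtain f where f: "\<forall>j\<le>m. 0 < s * (-1) ^ j * x (f j)" "\<forall>j<m. f j < f (Suc j)"
    using assms unfolding alternates_def by blast
  have mono: "f i \<le> f j" if "i \<le> j" "j \<le> m" for i j
    using bounded_chain_mono[OF f(2)] that by blast
  have "\<exists>p. p \<in> sign_change_pairs x \<and> f j \<le> fst p \<and> snd p \<le> f (Suc j)" if "j < m" for j
  proof -
    have "0 < s * (-1) ^ j * x (f j)" "0 < s * (-1) ^ Suc j * x (f (Suc j))"
      using f(1)[rule_format, of j] f(1)[rule_format, of "Suc j"] that by simp_all
    then have "x (f j) * x (f (Suc j)) < 0"
      by (auto simp: zero_less_mult_iff mult_less_0_iff)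
    then show ?thesis using sign_change_between[of "f j" "f (Suc j)" x] f(2) that
      by (metis fst_conv snd_conv)
  qed
  then obtain p
    where p: "\<And>j. j < m \<Longrightarrow> p j \<in> sign_change_pairs x \<and> f j \<le> fst (p j) \<and> snd (p j) \<le> f (Suc j)"
    by metis
  have lt: "fst q < snd q" if "q \<in> sign_change_pairs x" for q
    using that unfolding sign_change_pairs_def by auto
  have "inj_on p {..<m}"
  proof (rule linorder_inj_onI)
    fix i j assume ij: "i < j" "i \<in> {..<m}" "j \<in> {..<m}"
    then have "snd (p i) \<le> fst (p j)"
      using p[of i] p[of j] mono[of "Suc i" j] by fastforce
    then show "p i \<noteq> p j" using lt[of "p i"] p[of i] ij by auto
  qed auto
  then have "m \<le> card (sign_change_pairs x)"
    using card_inj_on_le[of p "{..<m}" "sign_change_pairs x"] True p by auto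
  then show ?thesis using True unfolding variation_def by simp
qed (simp add: variation_def)

lemma alternates_append:
  assumes f: "\<forall>j\<le>m. f j \<in> D \<and> 0 < s * (-1) ^ j * x (f j)" "\<forall>j<m. f j < f (Suc j)"
    and i: "i \<in> D" "0 < s * (-1) ^ Suc m * x i" "f m < i"
  shows "\<exists>h. (\<forall>j\<le>Suc m. h j \<in> D \<and> 0 < s * (-1) ^ j * x (h j)) \<and> (\<forall>j<Suc m. h j < h (Suc j))
    \<and> h (Suc m) = i"
proof (intro exI[of _ "f(Suc m := i)"] conjI allI impI)
  fix j assume "j < Suc m"
  then show "(f(Suc m := i)) j < (f(Suc m := i)) (Suc j)"
    using f(2) i(3) by (cases "j = m") auto
qed (use f(1) i(1,2) in \<open>auto simp: le_Suc_eq\<close>)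

text \<open>Induction on the number of pairs, removing the pair \<open>(a, b)\<close> with the
  largest right end. The bound \<open>K\<close> keeps the remaining chain at or before
  \<open>a\<close>, so whichever of \<open>a\<close> and \<open>b\<close> has the required sign can
  be appended. Finite subsets \<open>F\<close> are used because the set of all pairs may be
  infinite.\<close>

lemma alternates_sign_change_pairs:
  assumes "finite F" "F \<subseteq> sign_change_pairs x" "0 < s * x i0" "\<And>i. i < i0 \<Longrightarrow> x i = 0"
    and "\<And>p. p \<in> F \<Longrightarrow> snd p \<le> K" "i0 \<le> K"
  shows "\<exists>f. (\<forall>j\<le>card F. f j \<in> UNIV \<and> 0 < s * (-1) ^ j * x (f j)) \<and> (\<forall>j<card F. f j < f (Suc j))
    \<and> f (card F) \<le> K"
  using assms(1,2,5,6)
proof (induction "card F" arbitrary: F K)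
  case 0
  then show ?case using assms(3) by (intro exI[of _ "\<lambda>_. i0"]) auto
next
  case (Suc m)
  then have "F \<noteq> {}" by auto
  then have "Max (snd ` F) \<in> snd ` F" using Suc by (intro Max_in) auto
  then obtain a b where ab: "(a, b) \<in> F" "Max (snd ` F) = b" by auto
  have ab': "a < b" "x a * x b < 0" "\<And>k. a < k \<Longrightarrow> k < b \<Longrightarrow> x k = 0"
    using ab(1) Suc.prems(2) unfolding sign_change_pairs_def by auto
  \<comment> \<open>Two distinct pairs cannot share their right end, since the left end is the last
    nonzero position before it. As the entries strictly between \<open>a\<close> and
    \<open>b\<close> vanish, every other pair ends at or before \<open>a\<close>.\<close>
  have le_a: "snd p \<le> a" if "p \<in> F - {(a, b)}" for p
  proof -
    obtain c d where p: "p = (c, d)" by (cases p)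
    have d: "d \<le> b" using ab(2) that p Suc.prems(1)
      by (metis Diff_iff Max_ge finite_imageI image_eqI snd_conv)
    have cd: "c < d" "x c * x d < 0" "\<And>k. c < k \<Longrightarrow> k < d \<Longrightarrow> x k = 0"
      using that p Suc.prems(2) unfolding sign_change_pairs_def by auto
    have "d \<noteq> b"
    proof
      assume "d = b"
      then have "c \<noteq> a" using that p by auto
      moreover have "x a \<noteq> 0" "x c \<noteq> 0" using ab'(2) cd(2) by auto
      ultimately show False using ab'(1) ab'(3)[of c] cd(1) cd(3)[of a] \<open>d = b\<close>
        by (meson linorder_neqE_nat)
    qed
    moreover have "x d \<noteq> 0" using cd by auto
    ultimately show ?thesis using ab'(3)[of d] d p by fastforce
  qed
  have i0a: "i0 \<le> a" using assms(4)[of a] ab'(2) by (cases "i0 \<le> a") auto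
  have m: "m = card (F - {(a, b)})" using Suc ab by simp
  obtain f where f: "\<forall>j\<le>m. f j \<in> UNIV \<and> 0 < s * (-1) ^ j * x (f j)"
    "\<forall>j<m. f j < f (Suc j)" "f m \<le> a"
    using Suc.hyps(1)[OF m _ _ le_a i0a] Suc.prems(1,2) m by auto
  have "\<exists>c\<in>{a, b}. 0 < s * (-1) ^ Suc m * x c"
    using ab'(2) assms(3) by (cases "even m") (auto simp: mult_less_0_iff zero_less_mult_iff)
  then obtain c where c: "c \<in> {a, b}" "0 < s * (-1) ^ Suc m * x c" by blast
  have "f m \<noteq> c" using f(1) c(2) by auto
  then have "f m < c" using f(3) c(1) ab'(1) by auto
  moreover have "c \<le> K" using c(1) ab ab'(1) Suc.prems(3)[of "(a, b)"] by auto
  ultimately show ?case using alternates_append[OF f(1,2) _ c(2)] Suc.hyps(2) by auto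
qed

section \<open>Variation and \<open>OVD\<close> in terms of alternating chains\<close>

lemma first_nonzero_Least:
  assumes "\<exists>i. x i \<noteq> 0"
  shows "\<exists>i0. first_nonzero x = x i0 \<and> x i0 \<noteq> 0 \<and> (\<forall>i<i0. x i = 0)"
proof (intro exI[of _ "LEAST i. x i \<noteq> 0"] conjI allI impI)
  show "x (LEAST i. x i \<noteq> 0) \<noteq> 0" using assms by (rule LeastI_ex)
  show "x i = 0" if "i < (LEAST i. x i \<noteq> 0)" for i using not_less_Least[OF that] by blast
qed (rule first_nonzero_def)

lemma variation_le_iff_alternates:
  assumes "\<exists>i. x i \<noteq> 0"
  shows "enat m \<le> variation x \<longleftrightarrow> alternates UNIV (sgn (first_nonzero x)) m x"
proof
  assume m: "enat m \<le> variation x"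
  obtain F where F: "F \<subseteq> sign_change_pairs x" "finite F" "card F = m"
  proof (cases "finite (sign_change_pairs x)")
    case True
    then have "m \<le> card (sign_change_pairs x)" using m by (simp add: variation_def)
    then show ?thesis using obtain_subset_with_card_n that by metis
  next
    case False
    then show ?thesis using infinite_arbitrarily_large that by metis
  qed
  obtain i0 where i0: "first_nonzero x = x i0" "x i0 \<noteq> 0" "\<forall>i<i0. x i = 0"
    using first_nonzero_Least assms by metis
  define K where "K = Max (insert i0 (snd ` F))"
  have "\<exists>f. (\<forall>j\<le>card F. f j \<in> UNIV \<and> 0 < sgn (x i0) * (-1) ^ j * x (f j)) \<and>
      (\<forall>j<card F. f j < f (Suc j)) \<and> f (card F) \<le> K"
    using F i0
    by (intro alternates_sign_change_pairs) (auto simp: K_def sgn_mult_self_eq mult_sgn_abs sgn_if)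
  then show "alternates UNIV (sgn (first_nonzero x)) m x"
    unfolding alternates_def F(3) i0(1) by blast
qed (rule alternates_le_variation)

text \<open>If the leading sign is the wrong one, a chain of the same length with the right sign
  exists as well, and the two together give a longer chain.\<close>

lemma alternates_sign_cases:
  assumes "alternates UNIV s m x" "\<bar>s\<bar> = 1"
  shows "s = sgn (first_nonzero x) \<or> enat (Suc m) \<le> variation x"
proof -
  have i: "\<exists>i. x i \<noteq> 0" using alternates_nonzero[OF assms(1)] .
  let ?t = "sgn (first_nonzero x)"
  have "?t \<noteq> 0" using first_nonzero_Least[OF i] by (auto simp: sgn_if)
  then have "s = ?t \<or> s = - ?t" using assms(2) by (auto simp: sgn_if abs_if split: if_splits)
  moreover have "enat (Suc m) \<le> variation x" if "s = - ?t"
  proof -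
    have "alternates UNIV (- s) m x"
      using alternates_le_variation[OF assms(1)] that variation_le_iff_alternates[OF i] by simp
    then show ?thesis using alternates_both_signs[OF assms(1)] alternates_le_variation by blast
  qed
  ultimately show ?thesis by blast
qed

text \<open>Pulling back chains captures both clauses of \<open>OVD\<close>: the length bounds the
  variation, and the leading sign gives the agreement of signs when the variations are
  equal.\<close>

lemma OVD_if_alternates:
  assumes "\<And>u s m. u \<in> U \<Longrightarrow> \<bar>s\<bar> = 1 \<Longrightarrow> alternates UNIV s m (\<sigma>' (X u)) \<Longrightarrow> alternates UNIV s m (\<sigma> u)"
  shows "OVD \<sigma> \<sigma>' U m X"
  unfolding OVD_def
proof (intro ballI impI)
  fix u assume u: "u \<in> U" and le: "variation (\<sigma> u) \<le> enat m"
  let ?x = "\<sigma> u" and ?y = "\<sigma>' (X u)"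
  show "variation ?y \<le> variation ?x \<and> (variation ?y = variation ?x \<and> (\<exists>i. ?x i \<noteq> 0) \<and> (\<exists>i. ?y i \<noteq> 0)
    \<longrightarrow> sgn (first_nonzero ?x) = sgn (first_nonzero ?y))"
  proof (cases "\<exists>i. ?y i \<noteq> 0")
    case False
    then have "sign_change_pairs ?y = {}" unfolding sign_change_pairs_def by auto
    then show ?thesis using False by (simp add: variation_def zero_enat_def[symmetric])
  next
    case True
    let ?s = "sgn (first_nonzero ?y)"
    have s: "\<bar>?s\<bar> = 1" using first_nonzero_Least[OF True] by (auto simp: sgn_if)
    have alt: "alternates UNIV ?s k ?x" if "enat k \<le> variation ?y" for k
      using assms[OF u s] variation_le_iff_alternates[OF True] that by blast
    have *: "variation ?y \<le> variation ?x"
    proof (rule ccontr)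
      assume "\<not> ?thesis"
      moreover obtain k where "variation ?x = enat k" using le by (metis enat_ile)
      ultimately have "enat (Suc k) \<le> variation ?y" by (simp add: Suc_ile_eq)
      then show False
        using alternates_le_variation[OF alt] \<open>variation ?x = enat k\<close> by fastforce
    qed
    moreover have "sgn (first_nonzero ?x) = ?s" if eq: "variation ?y = variation ?x"
    proof -
      obtain k where k: "variation ?x = enat k" using le by (metis enat_ile)
      show ?thesis using alternates_sign_cases[OF alt[of k] s] eq k by auto
    qed
    ultimately show ?thesis by blast
  qed
qed

text \<open>If the variation of the input exceeds \<open>m\<close>, dropping the last or the first
  point of a longer chain produces either leading sign. Otherwise both variations equal
  \<open>m\<close>, and the sign clause of \<open>OVD\<close> decides.\<close>

lemma alternates_if_OVD:
  assumes OVD: "\<And>m. OVD \<sigma> \<sigma>' U m X" and u: "u \<in> U" "\<exists>i. \<sigma> u i \<noteq> 0"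
    and s: "\<bar>s\<bar> = 1" and alt: "alternates UNIV s m (\<sigma>' (X u))"
  shows "alternates UNIV s m (\<sigma> u)"
proof -
  let ?x = "\<sigma> u" and ?y = "\<sigma>' (X u)"
  have fx: "sgn (first_nonzero ?x) = s \<or> sgn (first_nonzero ?x) = - s"
    using first_nonzero_Least[OF u(2)] s by (auto simp: sgn_if abs_if split: if_splits)
  have more: ?thesis if "enat (Suc m) \<le> variation ?x"
    using alternates_butlast[of UNIV s m ?x] alternates_tl[of UNIV "- s" m ?x]
      that fx variation_le_iff_alternates[OF u(2)] by auto
  show ?thesis
  proof (cases "variation ?x")
    case infinity
    then show ?thesis using more by simp
  next
    case (enat k)
    have le: "variation ?y \<le> variation ?x" and
      sg: "variation ?y = variation ?x \<Longrightarrow> (\<exists>i. ?y i \<noteq> 0) \<Longrightarrow> sgn (first_nonzero ?x) = sgn (first_nonzero ?y)"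
      using OVD[of k] u enat unfolding OVD_def by auto
    have m: "enat m \<le> variation ?y" using alternates_le_variation[OF alt] .
    show ?thesis
    proof (cases "m < k")
      case True
      then show ?thesis using more enat by simp
    next
      case False
      have "variation ?y \<noteq> \<infinity>" using le enat by (metis enat_ile enat.distinct(1))
      then have k: "k = m" "variation ?y = variation ?x" using m le enat False by auto
      have "\<exists>i. ?y i \<noteq> 0" using alternates_nonzero[OF alt] .
      then have "sgn (first_nonzero ?x) = s"
        using sg k alternates_sign_cases[OF alt s] enat by auto
      then show ?thesis using variation_le_iff_alternates[OF u(2)] enat k by auto
    qed
  qed
qed

section \<open>Descartes' rule of signs\<close>

text \<open>The combinatorial core of Rolle's argument, with \<open>y\<close> in the role of a
  derivative or difference of \<open>h\<close>. The half-open condition \<open>a \<le> c < b\<close>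
  makes the points found in consecutive gaps strictly increasing and admits discrete time.\<close>

lemma alternates_between:
  assumes alt: "alternates D s (Suc m) h"
    and pos: "\<And>a b. a \<in> D \<Longrightarrow> b \<in> D \<Longrightarrow> a < b \<Longrightarrow> h a < 0 \<Longrightarrow> 0 < h b \<Longrightarrow>
      \<exists>c\<in>E. a \<le> c \<and> c < b \<and> 0 < y c"
    and neg: "\<And>a b. a \<in> D \<Longrightarrow> b \<in> D \<Longrightarrow> a < b \<Longrightarrow> 0 < h a \<Longrightarrow> h b < 0 \<Longrightarrow>
      \<exists>c\<in>E. a \<le> c \<and> c < b \<and> y c < 0"
  shows "alternates E (- s) m y"
proof -
  obtain f where f: "\<forall>j\<le>Suc m. f j \<in> D \<and> 0 < s * (-1) ^ j * h (f j)"
    "\<forall>j<Suc m. f j < f (Suc j)"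
    using alt unfolding alternates_def by blast
  have "\<exists>c. c \<in> E \<and> f j \<le> c \<and> c < f (Suc j) \<and> 0 < - s * (-1) ^ j * y c" if "j \<le> m" for j
  proof -
    have j: "f j \<in> D" "f (Suc j) \<in> D" "f j < f (Suc j)" "0 < s * (-1) ^ j * h (f j)"
      "s * (-1) ^ j * h (f (Suc j)) < 0"
      using f that by (auto dest!: spec[of _ "Suc j"])
    show ?thesis
    proof (cases "0 < s * (-1) ^ j")
      case True
      then have "0 < h (f j)" "h (f (Suc j)) < 0"
        using j(4,5) by (auto simp: zero_less_mult_iff mult_less_0_iff)
      then obtain c where "c \<in> E" "f j \<le> c" "c < f (Suc j)" "y c < 0" using neg j(1-3) by blast
      then show ?thesis using mult_pos_neg[OF True, of "y c"] by (intro exI[of _ c]) simp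
    next
      case False
      moreover have "s * (-1) ^ j \<noteq> 0" using j(4) by (metis mult_zero_left less_irrefl)
      ultimately have neg: "s * (-1) ^ j < 0" by linarith
      then have "h (f j) < 0" "0 < h (f (Suc j))"
        using j(4,5) by (auto simp: zero_less_mult_iff mult_less_0_iff)
      then obtain c where "c \<in> E" "f j \<le> c" "c < f (Suc j)" "0 < y c" using pos j(1-3) by blast
      then show ?thesis using mult_neg_pos[OF neg, of "y c"] by (intro exI[of _ c]) simp
    qed
  qed
  then obtain c where c: "\<And>j. j \<le> m \<Longrightarrow>
      c j \<in> E \<and> f j \<le> c j \<and> c j < f (Suc j) \<and> 0 < - s * (-1) ^ j * y (c j)"
    by metis
  have "c j < c (Suc j)" if "j < m" for j using c[of j] c[of "Suc j"] that by auto
  with c show ?thesis unfolding alternates_def by blast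
qed

text \<open>The factor is zero at \<open>r\<close>, at most zero before it and at least zero after
  it, where \<open>u\<close> is nonzero. A chain of the products with leading sign
  \<open>- s\<close> therefore cannot start at or before \<open>r\<close>; beyond \<open>r\<close>
  it is a chain of \<open>u\<close>, and \<open>r\<close> can be put in front. Here
  \<open>\<kappa>\<close> stands for the exponents of a power series or the nodes of an exponential
  sum.\<close>

lemma alternates_mult_diff:
  fixes u \<kappa> :: "nat \<Rightarrow> real"
  assumes alt: "alternates UNIV (- s) m (\<lambda>k. (\<kappa> k - \<kappa> r) * u k)"
    and r: "0 < s * u r" "\<And>k. k < r \<Longrightarrow> s * u k \<le> 0"
    and \<kappa>: "\<And>k. u k \<noteq> 0 \<Longrightarrow> k < r \<Longrightarrow> \<kappa> k \<le> \<kappa> r" "\<And>k. u k \<noteq> 0 \<Longrightarrow> r < k \<Longrightarrow> \<kappa> r \<le> \<kappa> k"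
  shows "alternates UNIV s (Suc m) u"
proof -
  let ?v = "\<lambda>k. (\<kappa> k - \<kappa> r) * u k"
  obtain f where f: "\<forall>j\<le>m. f j \<in> UNIV \<and> 0 < - s * (-1) ^ j * ?v (f j)" "\<forall>j<m. f j < f (Suc j)"
    using alt unfolding alternates_def by blast
  have f0: "0 < - s * ?v (f 0)" using f(1) by (metis le0 power_0 mult_1_right)
  have "r < f 0"
  proof (rule ccontr)
    assume "\<not> r < f 0"
    moreover have "f 0 \<noteq> r" using f0 by auto
    ultimately have "f 0 < r" by simp
    then have "0 \<le> (\<kappa> (f 0) - \<kappa> r) * (s * u (f 0))"
      using r(2) \<kappa>(1)[of "f 0"] by (cases "u (f 0) = 0") (auto intro!: mult_nonpos_nonpos)
    then show False using f0 by (simp add: mult_ac)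
  qed
  have "0 < - s * (-1) ^ j * u (f j)" if "j \<le> m" for j
  proof -
    have "r < f j" using bounded_chain_mono[OF f(2), of 0 j] that \<open>r < f 0\<close> by auto
    moreover have *: "0 < (\<kappa> (f j) - \<kappa> r) * (- s * (-1) ^ j * u (f j))"
      using f(1) that by (simp add: mult_ac)
    ultimately have "0 \<le> \<kappa> (f j) - \<kappa> r" using \<kappa>(2)[of "f j"] by (cases "u (f j) = 0") auto
    then show ?thesis using * unfolding zero_less_mult_iff[of "\<kappa> (f j) - \<kappa> r"] by auto
  qed
  then show ?thesis using alternates_Cons[of m f UNIV s u r] f(2) r(1) \<open>r < f 0\<close> by auto
qed

lemma alternates_imp_positive:
  assumes "alternates D s m x" obtains i where "i \<in> D" "0 < s * x i"
  using assms unfolding alternates_def by (metis le0 power_0 mult_1_right)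

lemma alternates_0: "alternates D s 0 x \<longleftrightarrow> (\<exists>i\<in>D. 0 < s * x i)"
  unfolding alternates_def by auto

lemma exists_least_positive:
  fixes x :: "nat \<Rightarrow> real"
  assumes "0 < s * x i"
  obtains r where "0 < s * x r" "\<And>k. k < r \<Longrightarrow> s * x k \<le> 0"
proof
  show "0 < s * x (LEAST i. 0 < s * x i)" using assms by (rule LeastI)
  show "s * x k \<le> 0" if "k < (LEAST i. 0 < s * x i)" for k using not_less_Least[OF that] by simp
qed

text \<open>The operator \<open>x * d/dx - r\<close> multiplies the \<open>k\<close>-th coefficient
  by \<open>k - r\<close>; up to the factor \<open>x ^ (r + 1)\<close> it is the derivative of
  \<open>F x / x ^ r\<close>.\<close>

lemma power_series_mult_index:
  fixes u :: "nat \<Rightarrow> real"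
  assumes conv: "\<And>x. 0 < x \<Longrightarrow> x < 1 \<Longrightarrow> summable (\<lambda>k. u k * x ^ k)" and x: "0 < x" "x < 1"
  defines "F \<equiv> \<lambda>x. \<Sum>k. u k * x ^ k"
  shows "\<exists>D. (F has_real_derivative D) (at x) \<and> (\<lambda>k. (real k - real r) * u k * x ^ k) sums (x * D - real r * F x)"
proof -
  obtain y where y: "x < y" "y < 1" using x(2) dense by blast
  have sy: "summable (\<lambda>k. u k * y ^ k)" using conv[of y] x y by auto
  let ?D = "\<Sum>k. diffs u k * x ^ k"
  have D: "(F has_real_derivative ?D) (at x)"
    unfolding F_def using sy y x by (intro termdiffs_strong) auto
  have "summable (\<lambda>k. diffs u k * x ^ k)"
  proof (rule termdiff_converges[of x 1])
    fix z :: real assume "norm z < 1"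
    then obtain w where w: "norm z < w" "w < 1" using dense by blast
    then have "0 < w" using norm_ge_zero[of z] by linarith
    show "summable (\<lambda>k. u k * z ^ k)"
      by (rule powser_inside[OF conv[OF \<open>0 < w\<close> w(2)]]) (use w \<open>0 < w\<close> in simp)
  qed (use x in simp)
  then have "(\<lambda>k. real k * u k * x ^ (k - Suc 0)) sums ?D" by (rule diffs_equiv)
  from sums_mult[OF this, of x]
  have "(\<lambda>k. real k * u k * x ^ k) sums (x * ?D)"
    by (rule sums_cong[THEN iffD1, rotated]) (case_tac n, auto)
  moreover have "(\<lambda>k. real r * (u k * x ^ k)) sums (real r * F x)"
    unfolding F_def using conv x by (intro sums_mult summable_sums) auto
  ultimately have "(\<lambda>k. real k * u k * x ^ k - real r * (u k * x ^ k)) sums (x * ?D - real r * F x)"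
    by (rule sums_diff)
  then show ?thesis using D by (auto simp: algebra_simps intro!: exI[of _ ?D])
qed

text \<open>Descartes' rule of signs, by induction on the length of the alternating chain: if \<open>u r\<close> is the
  first coefficient with the leading sign \<open>s\<close>, the derivative of \<open>F x / x ^ r\<close> loses one alternation
  by Rolle's theorem, and multiplication of the \<open>k\<close>-th coefficient by \<open>k - r\<close> kills \<open>u r\<close>.\<close>

lemma power_series_alternates_open:
  fixes u :: "nat \<Rightarrow> real"
  assumes "\<And>x. 0 < x \<Longrightarrow> x < 1 \<Longrightarrow> summable (\<lambda>k. u k * x ^ k)"
    and "alternates {0<..<1} s m (\<lambda>x. \<Sum>k. u k * x ^ k)"
  shows "alternates UNIV s m u"
  using assms
proof (induction m arbitrary: s u)
  case 0
  then obtain x where x: "0 < x" "x < 1" "0 < s * (\<Sum>k. u k * x ^ k)"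
    unfolding alternates_0 by auto
  have "\<exists>k. 0 < s * u k"
  proof (rule ccontr)
    assume "\<not> ?thesis"
    then have le: "s * u k \<le> 0" for k by (meson not_less)
    have "(\<Sum>k. s * (u k * x ^ k)) \<le> (\<Sum>k. 0)"
    proof (rule suminf_le)
      show "s * (u k * x ^ k) \<le> 0" for k
        using mult_nonpos_nonneg[OF le[of k], of "x ^ k"] x(1) by (simp add: mult_ac)
    qed (use 0 x in \<open>auto intro: summable_mult\<close>)
    then show False using x 0 by (simp add: suminf_mult)
  qed
  then show ?case by (simp add: alternates_0)
next
  case (Suc m)
  let ?F = "\<lambda>x. \<Sum>k. u k * x ^ k"
  have "\<exists>i. 0 < s * u i"
  proof -
    have "alternates {0<..<1} s m ?F" using alternates_butlast Suc.prems(2) by blast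
    then have "alternates UNIV s m u" using Suc.IH Suc.prems(1) by blast
    then show ?thesis by (metis alternates_imp_positive)
  qed
  then obtain r where r: "0 < s * u r" "\<And>k. k < r \<Longrightarrow> s * u k \<le> 0"
    using exists_least_positive[of s u] by metis
  let ?v = "\<lambda>k. (real k - real r) * u k"
  have deriv: "\<exists>D. (?F has_real_derivative D) (at x) \<and> (\<lambda>k. ?v k * x ^ k) sums (x * D - real r * ?F x)"
    if "0 < x" "x < 1" for x
    using power_series_mult_index[OF Suc.prems(1) that] by blast
  let ?h = "\<lambda>x. ?F x / x ^ r"
  have h': "(?h has_real_derivative (\<Sum>k. ?v k * x ^ k) / x ^ Suc r) (at x)"
    if x: "0 < x" "x < 1" for x
  proof -
    obtain D where D: "(?F has_real_derivative D) (at x)"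
      "(\<lambda>k. ?v k * x ^ k) sums (x * D - real r * ?F x)"
      using deriv[OF x] by blast
    have "((\<lambda>x. x ^ r) has_real_derivative real r * x ^ (r - 1)) (at x)"
      by (auto intro!: derivative_eq_intros)
    from DERIV_divide[OF D(1) this]
    have "(?h has_real_derivative (D * x ^ r - ?F x * (real r * x ^ (r - 1))) / (x ^ r * x ^ r)) (at x)"
      using x by simp
    moreover have "(D * x ^ r - ?F x * (real r * x ^ (r - 1))) / (x ^ r * x ^ r) = (x * D - real r * ?F x) / x ^ Suc r"
      using x by (cases r) (auto simp: field_simps)
    ultimately show ?thesis using sums_unique[OF D(2)] by simp
  qed
  have h: "alternates {0<..<1} s (Suc m) ?h"
    using Suc.prems(2) by (rule alternates_mono) (auto simp: divide_neg_pos)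
  \<comment> \<open>The product says that the new series at \<open>c\<close> has the sign of the
    increment of \<open>?h\<close>, which serves rises and falls alike.\<close>
  have mvt: "\<exists>c\<in>{0<..<1}. a \<le> c \<and> c < b \<and> 0 < (?h b - ?h a) * (\<Sum>k. ?v k * c ^ k)"
    if ab: "a \<in> {0<..<1}" "b \<in> {0<..<1}" "a < b" and ne: "?h b \<noteq> ?h a" for a b
  proof -
    obtain c where c: "a < c" "c < b" "?h b - ?h a = (b - a) * ((\<Sum>k. ?v k * c ^ k) / c ^ Suc r)"
      using MVT2[of a b ?h "\<lambda>x. (\<Sum>k. ?v k * x ^ k) / x ^ Suc r"] h' ab by auto
    then have nz: "(\<Sum>k. ?v k * c ^ k) \<noteq> 0" using ne by auto
    have "0 < c" using c ab by auto
    have "0 < (\<Sum>k. ?v k * c ^ k) * (\<Sum>k. ?v k * c ^ k)" using nz not_real_square_gt_zero by blast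
    moreover have "0 < (b - a) / c ^ Suc r" using ab(3) \<open>0 < c\<close> by simp
    ultimately have "0 < (b - a) / c ^ Suc r * ((\<Sum>k. ?v k * c ^ k) * (\<Sum>k. ?v k * c ^ k))"
      using mult_pos_pos by blast
    then show ?thesis using c ab by (intro bexI[of _ c]) (auto simp: mult_ac)
  qed
  have "alternates {0<..<1} (- s) m (\<lambda>x. \<Sum>k. ?v k * x ^ k)"
  proof (rule alternates_between[OF h])
    fix a b :: real assume ab: "a \<in> {0<..<1}" "b \<in> {0<..<1}" "a < b"
    show "\<exists>c\<in>{0<..<1}. a \<le> c \<and> c < b \<and> 0 < (\<Sum>k. ?v k * c ^ k)" if "?h a < 0" "0 < ?h b"
    proof -
      have pos: "0 < ?h b - ?h a" using that by linarith
      then obtain c where c: "c\<in>{0<..<1}" "a \<le> c" "c < b" "0 < (?h b - ?h a) * (\<Sum>k. ?v k * c ^ k)"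
        using mvt[OF ab] by auto
      then show ?thesis using zero_less_mult_pos[OF c(4) pos] by blast
    qed
    show "\<exists>c\<in>{0<..<1}. a \<le> c \<and> c < b \<and> (\<Sum>k. ?v k * c ^ k) < 0" if "0 < ?h a" "?h b < 0"
    proof -
      have neg: "?h b - ?h a < 0" using that by linarith
      then obtain c where c: "c\<in>{0<..<1}" "a \<le> c" "c < b" "0 < (?h b - ?h a) * (\<Sum>k. ?v k * c ^ k)"
        using mvt[OF ab] by auto
      then show ?thesis using neg unfolding zero_less_mult_iff by (intro bexI[of _ c]) auto
    qed
  qed
  moreover have "summable (\<lambda>k. ?v k * x ^ k)" if "0 < x" "x < 1" for x
    using deriv[OF that] by (auto simp: sums_iff)
  ultimately have "alternates UNIV (- s) m ?v" by (intro Suc.IH)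
  then show ?case by (rule alternates_mult_diff[where \<kappa> = real]) (use r in auto)
qed

text \<open>Only the first point of the chain can be \<open>0\<close>, and continuity allows moving
  it slightly to the right. The point \<open>0\<close> has to be covered because a transfer function
  may have a pole at the origin.\<close>

lemma power_series_alternates:
  fixes u :: "nat \<Rightarrow> real"
  assumes conv: "\<And>x. 0 < x \<Longrightarrow> x < 1 \<Longrightarrow> summable (\<lambda>k. u k * x ^ k)"
    and alt: "alternates {0..<1} s m (\<lambda>x. \<Sum>k. u k * x ^ k)"
  shows "alternates UNIV s m u"
proof -
  let ?F = "\<lambda>x. \<Sum>k. u k * x ^ k"
  obtain f where f: "\<forall>j\<le>m. f j \<in> {0..<1} \<and> 0 < s * (-1) ^ j * ?F (f j)" "\<forall>j<m. f j < f (Suc j)"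
    using alt unfolding alternates_def by blast
  \<comment> \<open>The upper limit for the moved point: the second point of the chain, or the end
    of the interval if there is none.\<close>
  define K where "K = (if m = 0 then 1 else f 1)"
  have K: "f 0 < K" "K \<le> 1"
    using f(1)[rule_format, of 0] f(1)[rule_format, of 1] f(2)[rule_format, of 0]
    unfolding K_def by (cases m; force)+
  have "\<exists>x. f 0 \<le> x \<and> 0 < x \<and> x < K \<and> 0 < s * ?F x"
  proof (cases "f 0 = 0")
    case True
    have "isCont ?F 0"
      using conv[of "1/2"] by (intro DERIV_isCont[OF termdiffs_strong[of u "1/2"]]) auto
    then have "((\<lambda>x. s * ?F x) \<longlongrightarrow> s * ?F 0) (at_right 0)"
      by (intro tendsto_intros) (auto simp: isCont_def intro: filterlim_at_split[THEN iffD1, THEN conjunct2])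
    moreover have "0 < s * ?F 0" using f(1) True by (metis le0 power_0 mult_1_right)
    ultimately have "\<forall>\<^sub>F x in at_right 0. 0 < s * ?F x" by (rule order_tendstoD)
    moreover have "\<forall>\<^sub>F x in at_right 0. x \<in> {0<..<K}"
      using K True by (intro eventually_at_right_real) auto
    ultimately have "\<forall>\<^sub>F x in at_right 0. x \<in> {0<..<K} \<and> 0 < s * ?F x" by eventually_elim auto
    then obtain x where "x \<in> {0<..<K} \<and> 0 < s * ?F x"
      using eventually_happens trivial_limit_at_right_real by blast
    then show ?thesis using True by (intro exI[of _ x]) auto
  next
    case False
    then show ?thesis using f(1) K by (intro exI[of _ "f 0"]) (force dest: spec[of _ 0])
  qed
  then obtain x where x: "f 0 \<le> x" "0 < x" "x < K" "0 < s * ?F x" by blast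
  have "alternates {0<..<1} s m ?F"
    unfolding alternates_def
  proof (intro exI[of _ "f(0 := x)"] conjI allI impI)
    fix j assume j: "j \<le> m"
    show "(f(0 := x)) j \<in> {0<..<1}"
    proof (cases j)
      case 0
      then show ?thesis using x K by auto
    next
      case (Suc i)
      have "0 \<le> f i" "f i < f j" "f j < 1" using f Suc j by auto
      then show ?thesis using Suc by auto
    qed
    show "0 < s * (- 1) ^ j * ?F ((f(0 := x)) j)" using f(1) j x(4) by auto
  next
    fix j assume j: "j < m"
    show "(f(0 := x)) j < (f(0 := x)) (Suc j)"
      using f(2) j x(3) by (cases j) (auto simp: K_def)
  qed
  then show ?thesis using power_series_alternates_open conv by blast
qed

text \<open>The induction of Descartes' rule with discrete time: the increments of
  \<open>?y t / p r ^ t\<close> are, up to a positive factor, an exponential sum with coefficients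
  \<open>(p i - p r) * x i\<close>, and telescoping replaces the mean value theorem.\<close>

lemma exponential_sum_alternates:
  fixes p x :: "nat \<Rightarrow> real"
  assumes p: "\<And>i j. i < j \<Longrightarrow> j < n \<Longrightarrow> p i < p j" "\<And>i. i < n \<Longrightarrow> 0 \<le> p i"
    and "\<And>i. n \<le> i \<Longrightarrow> x i = 0"
    and "alternates UNIV s m (\<lambda>t. \<Sum>i<n. x i * p i ^ t)"
  shows "alternates UNIV s m x"
  using assms(3,4)
proof (induction m arbitrary: s x)
  case 0
  then obtain t where t: "0 < s * (\<Sum>i<n. x i * p i ^ t)" unfolding alternates_0 by auto
  have "\<exists>i. 0 < s * x i"
  proof (rule ccontr)
    assume "\<not> ?thesis"
    then have le: "s * x i \<le> 0" for i by (meson not_less)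
    have "(\<Sum>i<n. (s * x i) * p i ^ t) \<le> 0"
      by (intro sum_nonpos, rule mult_nonpos_nonneg) (use le p(2) in auto)
    then show False using t by (simp add: sum_distrib_left mult_ac)
  qed
  then show ?case by (simp add: alternates_0)
next
  case (Suc m)
  let ?y = "\<lambda>t. \<Sum>i<n. x i * p i ^ t"
  have "\<exists>i. 0 < s * x i"
  proof -
    have "alternates UNIV s m ?y" using alternates_butlast Suc.prems(2) by blast
    then have "alternates UNIV s m x" using Suc.IH Suc.prems(1) by blast
    then show ?thesis by (metis alternates_imp_positive)
  qed
  then obtain r where r: "0 < s * x r" "\<And>k. k < r \<Longrightarrow> s * x k \<le> 0"
    using exists_least_positive[of s x] by metis
  have rn: "r < n" using r(1) Suc.prems(1)[of r] by (cases "r < n") auto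
  let ?v = "\<lambda>i. (p i - p r) * x i"
  have v: "(\<Sum>i<n. ?v i * p i ^ t) = ?y (Suc t) - p r * ?y t" for t
    by (simp add: sum_distrib_left sum_subtractf[symmetric] algebra_simps)
  have "alternates UNIV (- s) m (\<lambda>t. \<Sum>i<n. ?v i * p i ^ t)"
  \<comment> \<open>For a zero node no division by \<open>p r ^ t\<close> is possible, but the new
    sum is just \<open>?y\<close> advanced by one step. The chain without its first point, moved
    back by one, serves; its points are positive, so the subtraction is not truncated.\<close>
  proof (cases "p r = 0")
    case True
    obtain f where f: "\<forall>j\<le>Suc m. 0 < s * (-1) ^ j * ?y (f j)" "\<forall>j<Suc m. f j < f (Suc j)"
      using Suc.prems(2) unfolding alternates_def by blast
    have pos: "0 < f (Suc j)" if "j \<le> m" for j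
      using f(2) that by (metis gr0I less_Suc_eq_le not_less0)
    then have "0 < - s * (-1) ^ j * ?y (Suc (f (Suc j) - 1))" if "j \<le> m" for j
      using f(1)[rule_format, of "Suc j"] that by simp
    moreover have "f (Suc j) - 1 < f (Suc (Suc j)) - 1" if "j < m" for j
      using f(2)[rule_format, of "Suc j"] pos[of j] that by linarith
    ultimately show ?thesis unfolding alternates_def v using True
      by (intro exI[of _ "\<lambda>j. f (Suc j) - 1"]) auto
  next
    case False
    then have pr: "0 < p r" using p(2)[OF rn] by simp
    let ?h = "\<lambda>t. ?y t / p r ^ t"
    have h: "alternates UNIV s (Suc m) ?h"
      using Suc.prems(2) by (rule alternates_mono) (use pr in \<open>auto simp: divide_neg_pos\<close>)
    have step: "?h (Suc t) - ?h t = (?y (Suc t) - p r * ?y t) / p r ^ Suc t" for t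
      using pr by (simp add: field_simps)
    have tele: "?h b - ?h a = (\<Sum>t=a..<b. ?h (Suc t) - ?h t)" if "a < b" for a b
      using sum_Suc_diff'[of a b ?h] that by simp
    show ?thesis unfolding v
    proof (rule alternates_between[OF h])
      fix a b :: nat assume ab: "a < b"
      show "\<exists>c\<in>UNIV. a \<le> c \<and> c < b \<and> 0 < ?y (Suc c) - p r * ?y c" if "?h a < 0" "0 < ?h b"
      proof (rule ccontr)
        assume "\<not> ?thesis"
        then have "(\<Sum>t=a..<b. ?h (Suc t) - ?h t) \<le> 0"
          unfolding step using pr by (intro sum_nonpos divide_nonpos_pos) auto
        then show False using tele[OF ab] that by linarith
      qed
      show "\<exists>c\<in>UNIV. a \<le> c \<and> c < b \<and> ?y (Suc c) - p r * ?y c < 0" if "0 < ?h a" "?h b < 0"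
      proof (rule ccontr)
        assume "\<not> ?thesis"
        then have "0 \<le> (\<Sum>t=a..<b. ?h (Suc t) - ?h t)"
          unfolding step using pr by (intro sum_nonneg divide_nonneg_pos) auto
        then show False using tele[OF ab] that by linarith
      qed
    qed
  qed
  then have "alternates UNIV (- s) m ?v" by (rule Suc.IH[rotated]) (simp add: Suc.prems(1))
  then show ?case
  proof (rule alternates_mult_diff[where \<kappa> = p and r = r])
    show "s * x k \<le> 0" if "k < r" for k using r(2)[OF that] .
    show "p k \<le> p r" if "k < r" for k using p(1)[OF that rn] by simp
    show "p r \<le> p k" if "x k \<noteq> 0" "r < k" for k
      using p(1)[of r k] that Suc.prems(1)[of k] by (cases "k < n") auto
  qed (rule r(1))
qed

section \<open>Positive semidefiniteness of the Hankel matrices\<close>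

text \<open>The first-order condition at a minimum. It is applied to the minimizer of a quadratic
  form and to null vectors of the moment functional.\<close>

lemma quadratic_nonneg_imp_linear_zero:
  fixes a c :: real
  assumes "\<And>t. 0 \<le> t\<^sup>2 * a + 2 * t * c"
  shows "c = 0"
proof (rule ccontr)
  assume c: "c \<noteq> 0"
  \<comment> \<open>With this step size the linear term outweighs the quadratic one for every sign
    of \<open>a\<close>, and the denominator is never zero.\<close>
  define t where "t = - c / (\<bar>a\<bar> + 1)"
  have t: "c = - t * (\<bar>a\<bar> + 1)" unfolding t_def by (simp add: add_nonneg_eq_0_iff)
  have "t\<^sup>2 * a + 2 * t * c = t\<^sup>2 * (a - 2 * (\<bar>a\<bar> + 1))"
    unfolding t by (simp add: algebra_simps power2_eq_square)
  also have "\<dots> < 0" using c t by (intro mult_pos_neg) auto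
  finally show False using assms[of t] by simp
qed

lemma quadratic_form_add_basis:
  fixes b :: "nat \<Rightarrow> nat \<Rightarrow> real"
  assumes sym: "\<And>i j. b i j = b j i" and k: "k < N"
  shows "(\<Sum>i<N. \<Sum>j<N. b i j * (v i + t * of_bool (i = k)) * (v j + t * of_bool (j = k))) =
    (\<Sum>i<N. \<Sum>j<N. b i j * v i * v j) + 2 * t * (\<Sum>j<N. b k j * v j) + t\<^sup>2 * b k k"
proof -
  have "b i j * (v i + t * of_bool (i = k)) * (v j + t * of_bool (j = k)) =
      b i j * v i * v j + t * (if j = k then b i j * v i else 0) + t * (if i = k then b i j * v j else 0)
      + t\<^sup>2 * (if i = k then if j = k then b i j else 0 else 0)" for i j
    by (simp add: algebra_simps power2_eq_square)
  moreover have "(\<Sum>i<N. b i k * v i) = (\<Sum>j<N. b k j * v j)" by (simp add: sym)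
  moreover have "(\<Sum>i<N. \<Sum>j<N. if i = k then f i j else 0) = (\<Sum>j<N. f k j)" for f :: "nat \<Rightarrow> nat \<Rightarrow> real"
    using k by (subst sum.swap) simp
  ultimately show ?thesis
    using k by (simp add: sum.distrib sum_distrib_left[symmetric])
qed

text \<open>Vectors are functions on the naturals supported below \<open>N\<close>. Compactness
  follows from Tychonoff's theorem for a product of copies of \<open>[-1, 1]\<close> and
  \<open>{0}\<close>, cut by a closed condition.\<close>

lemma compact_unit_sphere:
  "compact {v :: nat \<Rightarrow> real. (\<forall>i\<ge>N. v i = 0) \<and> (\<Sum>i<N. (v i)\<^sup>2) = 1}"
proof -
  let ?B = "\<lambda>i::nat. if i < N then {-1..1::real} else {0}"
  have "compactin (product_topology (\<lambda>_. euclidean) UNIV) (PiE UNIV ?B)"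
    unfolding compactin_PiE by simp
  then have "compact (PiE UNIV ?B)" by (simp add: euclidean_product_topology)
  moreover have "closed {v :: nat \<Rightarrow> real. (\<Sum>i<N. (v i)\<^sup>2) = 1}"
    by (intro closed_Collect_eq continuous_intros continuous_on_product_coordinates)
  ultimately have "compact (PiE UNIV ?B \<inter> {v. (\<Sum>i<N. (v i)\<^sup>2) = 1})" by blast
  also have "PiE UNIV ?B \<inter> {v. (\<Sum>i<N. (v i)\<^sup>2) = 1} = {v. (\<forall>i\<ge>N. v i = 0) \<and> (\<Sum>i<N. (v i)\<^sup>2) = 1}"
  proof (intro subset_antisym subsetI)
    fix v :: "nat \<Rightarrow> real" assume v: "v \<in> PiE UNIV ?B \<inter> {v. (\<Sum>i<N. (v i)\<^sup>2) = 1}"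
    have "v i = 0" if "N \<le> i" for i using v that PiE_mem[of v UNIV ?B i] by simp
    then show "v \<in> {v. (\<forall>i\<ge>N. v i = 0) \<and> (\<Sum>i<N. (v i)\<^sup>2) = 1}" using v by blast
  next
    fix v :: "nat \<Rightarrow> real" assume "v \<in> {v. (\<forall>i\<ge>N. v i = 0) \<and> (\<Sum>i<N. (v i)\<^sup>2) = 1}"
    then have v: "\<forall>i\<ge>N. v i = 0" "(\<Sum>i<N. (v i)\<^sup>2) = 1" by auto
    have "\<bar>v i\<bar> \<le> 1" if "i < N" for i
      using member_le_sum[of i "{..<N}" "\<lambda>i. (v i)\<^sup>2"] v(2) that by (simp add: abs_square_le_1)
    then have "v i \<in> ?B i" for i using v(1) by (auto simp: abs_le_iff)
    then show "v \<in> PiE UNIV ?B \<inter> {v. (\<Sum>i<N. (v i)\<^sup>2) = 1}" using v(2) by auto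
  qed
  finally show ?thesis .
qed

text \<open>The eigenvector is a minimizer of the quadratic form on the unit sphere.\<close>

lemma negative_eigenvector:
  fixes a :: "nat \<Rightarrow> nat \<Rightarrow> real"
  assumes sym: "\<And>i j. a i j = a j i" and neg: "(\<Sum>i<N. \<Sum>j<N. a i j * w i * w j) < 0"
  obtains l v where "l < 0" "\<exists>i. v i \<noteq> 0" "\<And>i. N \<le> i \<Longrightarrow> v i = 0"
    "\<And>i. i < N \<Longrightarrow> (\<Sum>j<N. a i j * v j) = l * v i"
proof -
  define Q where "Q v = (\<Sum>i<N. \<Sum>j<N. a i j * v i * v j)" for v
  define S where "S = {v :: nat \<Rightarrow> real. (\<forall>i\<ge>N. v i = 0) \<and> (\<Sum>i<N. (v i)\<^sup>2) = 1}"
  have scale: "\<exists>v\<in>S. Q u = (\<Sum>i<N. (u i)\<^sup>2) * Q v" if ne: "(\<Sum>i<N. (u i)\<^sup>2) \<noteq> 0" for u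
  proof
    define n where "n = (\<Sum>i<N. (u i)\<^sup>2)"
    have n: "n > 0" using ne sum_nonneg[of "{..<N}" "\<lambda>i. (u i)\<^sup>2"] unfolding n_def by auto
    define v where "v i = (if i < N then u i / sqrt n else 0)" for i
    show "v \<in> S"
      using n
      by (auto simp: S_def v_def power_divide sum_divide_distrib[symmetric] n_def[symmetric])
    have "a i j * u i * u j = n * (a i j * v i * v j)" if "i < N" "j < N" for i j
      using that n unfolding v_def by (simp add: field_simps)
    then show "Q u = (\<Sum>i<N. (u i)\<^sup>2) * Q v"
      unfolding Q_def n_def[symmetric] sum_distrib_left by (intro sum.cong) auto
  qed
  have Q0: "Q u = 0" if "(\<Sum>i<N. (u i)\<^sup>2) = 0" for u
  proof -
    have "\<forall>i<N. u i = 0" using that by (simp add: sum_nonneg_eq_0_iff)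
    then show ?thesis unfolding Q_def by simp
  qed
  have Qw: "Q w < 0" using neg unfolding Q_def .
  then obtain w' where w': "w' \<in> S" "Q w = (\<Sum>i<N. (w i)\<^sup>2) * Q w'"
    using scale[of w] Q0[of w] by fastforce
  have "continuous_on S Q" unfolding Q_def
    by (intro continuous_intros continuous_on_subset[OF continuous_on_product_coordinates]) auto
  then obtain v where v: "v \<in> S" "\<And>u. u \<in> S \<Longrightarrow> Q v \<le> Q u"
    using continuous_attains_inf[of S Q] w'(1) compact_unit_sphere[of N] unfolding S_def by blast
  define l where "l = Q v"
  have "Q w' < 0" using Qw w'(2) sum_nonneg[of "{..<N}" "\<lambda>i. (w i)\<^sup>2"]
    by (auto simp: mult_less_0_iff)
  then have l: "l < 0" using v(2)[OF w'(1)] unfolding l_def by simp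
  have ge: "l * (\<Sum>i<N. (u i)\<^sup>2) \<le> Q u" for u
  proof (cases "(\<Sum>i<N. (u i)\<^sup>2) = 0")
    case False
    then obtain v' where "v' \<in> S" "Q u = (\<Sum>i<N. (u i)\<^sup>2) * Q v'" using scale by blast
    then show ?thesis using v(2)[of v'] sum_nonneg[of "{..<N}" "\<lambda>i. (u i)\<^sup>2"]
      unfolding l_def by (simp add: mult.commute[of "Q v"] mult_left_mono)
  qed (use Q0 in simp)
  \<comment> \<open>The form of \<open>b\<close> is nonnegative by \<open>ge\<close> and vanishes at
    \<open>v\<close>. Varying \<open>v\<close> along the \<open>k\<close>-th unit vector gives the
    \<open>k\<close>-th eigenvalue equation.\<close>
  define b where "b i j = a i j - l * of_bool (i = j)" for i j
  have Qb: "(\<Sum>i<N. \<Sum>j<N. b i j * u i * u j) = Q u - l * (\<Sum>i<N. (u i)\<^sup>2)" for u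
  proof -
    have "(\<Sum>j<N. b i j * u i * u j) = (\<Sum>j<N. a i j * u i * u j) - l * (u i)\<^sup>2" if "i < N" for i
    proof -
      have "b i j * u i * u j = a i j * u i * u j - (if j = i then l * u i * u j else 0)" for j
        unfolding b_def by (simp add: algebra_simps)
      then show ?thesis using that by (simp add: sum_subtractf power2_eq_square mult_ac)
    qed
    then show ?thesis unfolding Q_def by (simp add: sum_subtractf sum_distrib_left)
  qed
  have v1: "(\<Sum>i<N. (v i)\<^sup>2) = 1" "\<And>i. N \<le> i \<Longrightarrow> v i = 0" using v(1) unfolding S_def by auto
  have "(\<Sum>j<N. a k j * v j) = l * v k" if k: "k < N" for k
  proof -
    have "0 \<le> t\<^sup>2 * b k k + 2 * t * (\<Sum>j<N. b k j * v j)" for t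
    proof -
      have "0 \<le> (\<Sum>i<N. \<Sum>j<N. b i j * (v i + t * of_bool (i = k)) * (v j + t * of_bool (j = k)))"
        using ge[of "\<lambda>i. v i + t * of_bool (i = k)"] unfolding Qb by simp
      also have "\<dots> = (\<Sum>i<N. \<Sum>j<N. b i j * v i * v j) + 2 * t * (\<Sum>j<N. b k j * v j) + t\<^sup>2 * b k k"
        using k sym by (intro quadratic_form_add_basis) (auto simp: b_def)
      also have "(\<Sum>i<N. \<Sum>j<N. b i j * v i * v j) = 0" unfolding Qb v1(1) l_def by simp
      finally show ?thesis by simp
    qed
    then have "(\<Sum>j<N. b k j * v j) = 0" by (rule quadratic_nonneg_imp_linear_zero)
    moreover have "b k j * v j = a k j * v j - (if j = k then l * v j else 0)" for j
      unfolding b_def by (simp add: algebra_simps)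
    ultimately show ?thesis using k by (simp add: sum_subtractf)
  qed
  moreover have "\<exists>i. v i \<noteq> 0" using v1(1)
    by (metis (no_types, lifting) sum.neutral power_zero_numeral zero_neq_one)
  ultimately show ?thesis using that l v1(2) by blast
qed

section \<open>Finite sections of the Hankel operator\<close>

definition past_input_of :: "(nat \<Rightarrow> real) \<Rightarrow> int \<Rightarrow> real" where
  "past_input_of v \<tau> = v (nat (- \<tau> - 1))"

lemma past_entries_past_input_of: "past_entries (past_input_of v) = v"
  unfolding past_entries_def past_input_of_def by auto

lemma hankel_op_past_input_of:
  assumes "\<And>i. N \<le> i \<Longrightarrow> v i = 0"
  shows "hankel_op g (past_input_of v) t = (\<Sum>j<N. g (t + Suc j) * v j)"
  unfolding hankel_op_def past_input_of_def
  by (subst suminf_finite[of "{..<N}"]) (auto simp: assms)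

text \<open>Only a window of the output is known: its entries from \<open>d\<close> to
  \<open>d + N - 1\<close> are those of \<open>l * v\<close>. A chain inside the window is still a
  chain of the whole output, so the other entries do no harm. Pulled back to \<open>v\<close>, it
  has the wrong leading sign and forces more sign changes than \<open>v\<close> has.\<close>

lemma hankel_totally_positive_nonneg:
  assumes "hankel_totally_positive g"
  shows "0 \<le> (\<Sum>i<N. \<Sum>j<N. g (Suc (i + j + d)) * w i * w j)"
proof (rule ccontr)
  assume "\<not> ?thesis"
  then have neg: "(\<Sum>i<N. \<Sum>j<N. g (Suc (i + j + d)) * w i * w j) < 0" by simp
  obtain l v where l: "l < 0" and v: "\<exists>i. v i \<noteq> 0" "\<And>i. N \<le> i \<Longrightarrow> v i = 0"
    and eig: "\<And>i. i < N \<Longrightarrow> (\<Sum>j<N. g (Suc (i + j + d)) * v j) = l * v i"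
    by (rule negative_eigenvector[OF _ neg]) (auto simp: add_ac)
  let ?u = "past_input_of v" and ?y = "hankel_op g (past_input_of v)"
  have OVD: "OVD past_entries (\<lambda>y. y) past_inputs m (hankel_op g)" for m
    using assms unfolding hankel_totally_positive_def by (metis add_diff_cancel_right' le_add2)
  have y: "?y (i + d) = l * v i" if "i < N" for i
    using eig[OF that] hankel_op_past_input_of[of N v g "i + d"] v(2) by (simp add: add_ac)
  have "sign_change_pairs v \<subseteq> {..<N} \<times> {..<N}"
    using v(2) unfolding sign_change_pairs_def by (auto simp: not_le[symmetric])
  then have "finite (sign_change_pairs v)" by (rule finite_subset) simp
  then obtain k where k: "variation v = enat k" unfolding variation_def by auto
  let ?s = "sgn (first_nonzero v)"
  have s: "\<bar>- ?s\<bar> = 1" using first_nonzero_Least[OF v(1)] by (auto simp: sgn_if)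
  have "alternates UNIV ?s k v" using variation_le_iff_alternates[OF v(1), of k] k by simp
  then obtain f where f: "\<forall>j\<le>k. 0 < ?s * (-1) ^ j * v (f j)" "\<forall>j<k. f j < f (Suc j)"
    unfolding alternates_def by blast
  have "0 < - ?s * (-1) ^ j * ?y (f j + d)" if "j \<le> k" for j
  proof -
    have *: "0 < ?s * (-1) ^ j * v (f j)" using f(1) that by blast
    then have "f j < N" using v(2)[of "f j"] by (cases "f j < N") auto
    then show ?thesis using mult_pos_pos[OF *, of "- l"] l y by (simp add: mult_ac)
  qed
  then have "alternates UNIV (- ?s) k ?y"
    using f(2) unfolding alternates_def by (intro exI[of _ "\<lambda>j. f j + d"]) auto
  moreover have "v \<longlonglongrightarrow> 0"
    by (rule tendsto_eventually) (use v(2) in \<open>auto simp: eventually_sequentially\<close>)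
  then have "?u \<in> past_inputs"
    unfolding past_inputs_def past_entries_past_input_of mem_Collect_eq
    by (intro convergent_imp_Bseq convergentI)
  ultimately have "alternates UNIV (- ?s) k v"
    using alternates_if_OVD[OF OVD, of ?u "- ?s" k] v(1) s unfolding past_entries_past_input_of
    by blast
  from alternates_sign_cases[OF this s] show False using s k by auto
qed

section \<open>Linear recurrences and transfer functions\<close>

lemma powser_at_right_0:
  fixes a :: "nat \<Rightarrow> real"
  assumes "0 < e" "\<And>w. 0 < w \<Longrightarrow> w < e \<Longrightarrow> (\<lambda>t. a t * w ^ t) sums F w"
  shows "(F \<longlongrightarrow> a 0) (at_right 0)"
proof -
  let ?F = "\<lambda>w. \<Sum>t. a t * w ^ t"
  have "summable (\<lambda>t. a t * (e / 2) ^ t)" using assms by (auto simp: sums_iff)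
  then have "isCont ?F 0" using assms(1)
    by (intro DERIV_isCont[OF termdiffs_strong[of a "e / 2"]]) auto
  then have "(?F \<longlongrightarrow> ?F 0) (at 0)" unfolding isCont_def .
  then have "(?F \<longlongrightarrow> a 0) (at_right 0)" by (auto simp: filterlim_at_split)
  moreover have "\<forall>\<^sub>F w in at_right 0. w \<in> {0<..<e}"
    using assms(1) by (rule eventually_at_right_real)
  then have "\<forall>\<^sub>F w in at_right 0. ?F w = F w"
    by eventually_elim (use assms(2) in \<open>auto simp: sums_iff\<close>)
  ultimately show ?thesis by (rule Lim_transform_eventually)
qed

lemma powser_eq_0_imp_coeff_0:
  fixes a :: "nat \<Rightarrow> real"
  assumes "0 < e" "\<And>w. 0 < w \<Longrightarrow> w < e \<Longrightarrow> (\<lambda>t. a t * w ^ t) sums 0"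
  shows "a t = 0"
  using assms(2)
proof (induction t arbitrary: a)
  case 0
  have "((\<lambda>_::real. 0) \<longlongrightarrow> a 0) (at_right 0)" by (rule powser_at_right_0[OF assms(1) 0])
  then show ?case by (simp add: tendsto_const_iff)
next
  case (Suc t)
  have "((\<lambda>_::real. 0) \<longlongrightarrow> a 0) (at_right 0)" by (rule powser_at_right_0[OF assms(1) Suc.prems])
  then have a0: "a 0 = 0" by (simp add: tendsto_const_iff)
  have "(\<lambda>t. a (Suc t) * w ^ t) sums 0" if w: "0 < w" "w < e" for w
  proof -
    have "(\<lambda>t. a (Suc t) * w ^ Suc t) sums 0"
      using Suc.prems[OF w] a0 by (subst sums_Suc_iff) simp
    from sums_mult[OF this, of "1 / w"] show ?thesis using w by simp
  qed
  then show ?case by (rule Suc.IH)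
qed

text \<open>Substitute \<open>w = 1 / z\<close>: the series times \<open>z\<close> is a power series
  in \<open>w\<close> and tends to \<open>a 0\<close> as \<open>w\<close> decreases to
  \<open>0\<close>, whereas \<open>z * poly p z\<close> is unbounded unless \<open>p = 0\<close>.
  The factor \<open>[:0, 1:]\<close> makes this work for constant \<open>p\<close> too.\<close>

lemma poly_eq_tail_series:
  fixes p :: "real poly"
  assumes "\<And>z. R < z \<Longrightarrow> (\<lambda>t. a t / z ^ Suc t) sums poly p z"
  shows "p = 0" "a t = 0"
proof -
  define e where "e = 1 / (\<bar>R\<bar> + 1)"
  have e: "0 < e" unfolding e_def by simp
  have sums: "(\<lambda>t. a t * w ^ t) sums poly ([:0, 1:] * p) (1 / w)" if w: "0 < w" "w < e" for w
  proof -
    have "\<bar>R\<bar> + 1 < 1 / w" using w unfolding e_def by (simp add: field_simps)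
    then have "R < 1 / w" by linarith
    from sums_mult[OF assms[OF this], of "1 / w"] show ?thesis
      using w by (simp add: power_one_over field_simps)
  qed
  show "p = 0"
  proof (rule ccontr)
    assume "p \<noteq> 0"
    then have "filterlim (poly ([:0, 1:] * p)) at_infinity at_infinity"
      by (intro filterlim_poly_at_infinity) (simp add: degree_mult_eq)
    moreover have "filterlim (\<lambda>w::real. 1 / w) at_infinity (at_right 0)"
      using filterlim_inverse_at_top_right
      by (auto simp: inverse_eq_divide intro: filterlim_at_top_imp_at_infinity)
    ultimately have "filterlim (\<lambda>w. poly ([:0, 1:] * p) (1 / w)) at_infinity (at_right 0)"
      by (rule filterlim_compose)
    moreover have "((\<lambda>w. poly ([:0, 1:] * p) (1 / w)) \<longlongrightarrow> a 0) (at_right 0)"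
      by (rule powser_at_right_0[OF e sums])
    ultimately show False
      by (meson not_tendsto_and_filterlim_at_infinity trivial_limit_at_right_real)
  qed
  then show "a t = 0" using powser_eq_0_imp_coeff_0[OF e] sums by simp
qed

text \<open>This is \<open>p\<close> evaluated at the forward shift operator and applied to
  \<open>g\<close>, so products of polynomials become compositions.\<close>

definition poly_shift :: "real poly \<Rightarrow> (nat \<Rightarrow> real) \<Rightarrow> nat \<Rightarrow> real" where
  "poly_shift p g t = (\<Sum>j\<le>degree p. coeff p j * g (t + j))"

lemma poly_shift_altdef:
  assumes "degree p \<le> n" shows "poly_shift p g t = (\<Sum>j\<le>n. coeff p j * g (t + j))"
  unfolding poly_shift_def using assms
  by (intro sum.mono_neutral_left) (auto simp: coeff_eq_0)

lemma poly_shift_0 [simp]: "poly_shift 0 g t = 0"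
  by (simp add: poly_shift_def)

lemma poly_shift_pCons: "poly_shift (pCons a p) g t = a * g t + poly_shift p g (Suc t)"
proof -
  have "poly_shift (pCons a p) g t = (\<Sum>j\<le>Suc (degree p). coeff (pCons a p) j * g (t + j))"
    by (rule poly_shift_altdef) (simp add: degree_pCons_le)
  also have "\<dots> = a * g t + poly_shift p g (Suc t)"
    by (subst sum.atMost_Suc_shift) (simp add: poly_shift_def)
  finally show ?thesis .
qed

lemma poly_shift_add: "poly_shift (p + q) g t = poly_shift p g t + poly_shift q g t"
  by (simp add: poly_shift_altdef[of _ "max (degree p) (degree q)"] degree_add_le
      sum.distrib algebra_simps)

lemma poly_shift_smult: "poly_shift (Polynomial.smult c p) g t = c * poly_shift p g t"
  by (simp add: poly_shift_altdef[of "Polynomial.smult c p" "degree p"] poly_shift_def sum_distrib_left mult_ac)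

lemma poly_shift_mult: "poly_shift (p * q) g t = poly_shift p (poly_shift q g) t"
proof (induction p arbitrary: t)
  case (pCons a p)
  then show ?case by (simp add: poly_shift_pCons poly_shift_add poly_shift_smult)
qed simp

text \<open>Multiplication by \<open>poly p z\<close> shifts the series, and the terms with
  nonnegative powers of \<open>z\<close> form the polynomial \<open>N\<close>. Following Horner's
  scheme, each factor \<open>z\<close> moves one term, with coefficient \<open>?c\<close>, from the
  series into the constant term of \<open>N\<close>.\<close>

lemma poly_shift_series:
  fixes H :: "real \<Rightarrow> real"
  assumes "\<And>z. 1 < z \<Longrightarrow> (\<lambda>t. g (Suc t) / z ^ Suc t) sums H z"
  shows "\<exists>N. \<forall>z>1. (\<lambda>t. poly_shift p g (Suc t) / z ^ Suc t) sums (H z * poly p z - poly N z)"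
proof (induction p)
  case 0
  then show ?case by (intro exI[of _ 0]) simp
next
  case (pCons a p)
  then obtain N
    where N: "\<And>z. 1 < z \<Longrightarrow> (\<lambda>t. poly_shift p g (Suc t) / z ^ Suc t) sums (H z * poly p z - poly N z)"
    by blast
  let ?c = "poly_shift p g 1"
  have "(\<lambda>t. poly_shift (pCons a p) g (Suc t) / z ^ Suc t) sums (H z * poly (pCons a p) z - poly (pCons ?c N) z)"
    if z: "1 < z" for z
  proof -
    let ?f = "\<lambda>t. poly_shift p g (Suc t) / z ^ Suc t"
    have "(\<lambda>t. ?f (Suc t)) sums (H z * poly p z - poly N z - ?c / z)"
      using N[OF z] by (subst sums_Suc_iff) simp
    from sums_add[OF sums_mult[OF assms[OF z], of a] sums_mult[OF this, of z]]
    have "(\<lambda>t. a * (g (Suc t) / z ^ Suc t) + z * ?f (Suc t)) sums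
      (a * H z + z * (H z * poly p z - poly N z - ?c / z))" .
    moreover have "a * (g (Suc t) / z ^ Suc t) + z * ?f (Suc t) = poly_shift (pCons a p) g (Suc t) / z ^ Suc t" for t
      using z by (simp add: poly_shift_pCons field_simps)
    moreover have "a * H z + z * (H z * poly p z - poly N z - ?c / z) = H z * poly (pCons a p) z - poly (pCons ?c N) z"
      using z by (simp add: algebra_simps)
    ultimately show ?thesis by simp
  qed
  then show ?case by blast
qed

section \<open>The denominator as minimal annihilator of the impulse response\<close>

lemma map_poly_of_real_eval:
  "poly (map_poly complex_of_real p) (complex_of_real x) = complex_of_real (poly p x)"
  by (induction p) (auto simp: map_poly_pCons)

lemma poly_eq_if_eq_large:
  fixes p q :: "real poly"
  assumes "\<And>z. R < z \<Longrightarrow> poly p z = poly q z" shows "p = q"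
proof (rule ccontr)
  assume "p \<noteq> q"
  then have "finite {z. poly (p - q) z = 0}" by (intro poly_roots_finite) simp
  moreover have "{R<..} \<subseteq> {z. poly (p - q) z = 0}" using assms by auto
  ultimately show False using infinite_Ioi finite_subset by blast
qed

lemma denom_nonzero: "denom G \<noteq> 0"
  unfolding denom_def by (rule snd_quot_of_fract_nonzero)

text \<open>The series multiplied by the denominator is a polynomial, so its tail coefficients
  vanish. Conversely, an annihilator \<open>r\<close> turns \<open>numer G * r / denom G\<close>
  into a polynomial, and coprimality gives the divisibility.\<close>

lemma transfer_function_denom:
  assumes "transfer_function G g"
  shows poly_shift_denom: "poly_shift (denom G) g (Suc t) = 0"
    and denom_dvd_if_poly_shift_0: "(\<And>t. poly_shift r g (Suc t) = 0) \<Longrightarrow> denom G dvd r"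
proof -
  define H where "H z = (\<Sum>t. g (Suc t) / z ^ Suc t)" for z :: real
  have ex: "(\<lambda>t. complex_of_real (g (Suc t) / z ^ Suc t)) sums
      complex_of_real (poly (numer G) z / poly (denom G) z)" if "1 < z" for z
    using assms that unfolding transfer_function_def eval_fract_def
    by (auto simp: map_poly_of_real_eval dest!: spec[of _ "complex_of_real z"])
  have Hq: "(\<lambda>t. g (Suc t) / z ^ Suc t) sums (poly (numer G) z / poly (denom G) z)" if "1 < z" for z
    using ex[OF that] unfolding sums_of_real_iff .
  then have H: "(\<lambda>t. g (Suc t) / z ^ Suc t) sums H z" if "1 < z" for z
    using that unfolding H_def by (auto simp: sums_iff)
  \<comment> \<open>Beyond all real roots of the denominator the quotient is a genuine one, not the
    default value of division by zero.\<close>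
  obtain R where R: "1 \<le> R" "\<And>z. R < z \<Longrightarrow> poly (denom G) z \<noteq> 0"
  proof -
    have fin: "finite {z. poly (denom G) z = 0}" using denom_nonzero by (rule poly_roots_finite)
    let ?M = "Max (insert 1 {z. poly (denom G) z = 0})"
    have "poly (denom G) z \<noteq> 0" if "?M < z" for z
      using Max_ge[of "insert 1 {z. poly (denom G) z = 0}" z] fin that by fastforce
    moreover have "1 \<le> ?M" using fin by (intro Max_ge) auto
    ultimately show ?thesis using that by blast
  qed
  have Hnum: "H z * poly (denom G) z = poly (numer G) z" if "R < z" for z
    using Hq[of z] H[of z] R that sums_unique2 by (fastforce simp: field_simps)
  show "poly_shift (denom G) g (Suc t) = 0"
  proof -
    obtain N where N: "\<And>z. 1 < z \<Longrightarrow> (\<lambda>t. poly_shift (denom G) g (Suc t) / z ^ Suc t) sums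
        (H z * poly (denom G) z - poly N z)"
      using poly_shift_series[of g H "denom G"] H by blast
    have "(\<lambda>t. poly_shift (denom G) g (Suc t) / z ^ Suc t) sums poly (numer G - N) z"
      if "R < z" for z
      using N[of z] Hnum[OF that] R(1) that by simp
    then show ?thesis by (rule poly_eq_tail_series(2))
  qed
  show "denom G dvd r" if r: "\<And>t. poly_shift r g (Suc t) = 0"
  proof -
    obtain N where N: "\<And>z. 1 < z \<Longrightarrow> (\<lambda>t. poly_shift r g (Suc t) / z ^ Suc t) sums
        (H z * poly r z - poly N z)"
      using poly_shift_series[of g H r] H by blast
    have "poly (numer G * r) z = poly (denom G * N) z" if z: "R < z" for z
    proof -
      have "H z * poly r z = poly N z"
        using N[of z] R(1) z r by (simp add: sums_iff)
      then show ?thesis unfolding poly_mult Hnum[OF z, symmetric] by (simp add: mult_ac)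
    qed
    then have "numer G * r = denom G * N" by (rule poly_eq_if_eq_large)
    then have "denom G dvd numer G * r" by simp
    moreover have "coprime (denom G) (numer G)"
      unfolding denom_def numer_def using coprime_quot_of_fract[of G] by (simp add: coprime_commute)
    ultimately show ?thesis using coprime_dvd_mult_right_iff by blast
  qed
qed

section \<open>Nonnegative moment functionals\<close>

text \<open>The setting of a Stieltjes moment problem whose solution is finitely supported:
  \<open>D\<close> generates the ideal of annihilators of \<open>g\<close> from index 1 on, and the
  functional is nonnegative on the polynomials \<open>q * q\<close> and
  \<open>x * q * q\<close>.\<close>

locale nonneg_moment_functional =
  fixes D :: "real poly" and g :: "nat \<Rightarrow> real"
  assumes D_nonzero: "D \<noteq> 0"
    and annihilates: "poly_shift D g (Suc t) = 0"
    and minimal: "(\<And>t. poly_shift r g (Suc t) = 0) \<Longrightarrow> D dvd r"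
    and nonneg: "0 \<le> poly_shift (q * q) g 1" "0 \<le> poly_shift (pCons 0 (q * q)) g 1"
begin

definition L :: "real poly \<Rightarrow> real" where "L q = poly_shift q g 1"

lemma L_add: "L (p + q) = L p + L q" and L_smult: "L (Polynomial.smult c p) = c * L p"
  by (simp_all add: L_def poly_shift_add poly_shift_smult)

lemma L_diff: "L (p - q) = L p - L q"
  using L_add[of "p - q" q] by simp

lemma L_sum: "L (\<Sum>i\<in>A. f i) = (\<Sum>i\<in>A. L (f i))"
proof (induction A rule: infinite_finite_induct)
  case (insert x F)
  then show ?case by (simp add: L_add)
qed (simp_all add: L_def)

lemma L_dvd: assumes "D dvd p" shows "L p = 0"
proof -
  obtain k where "p = k * D" using assms by (metis dvdE mult.commute)
  then show ?thesis
    using annihilates by (simp add: L_def poly_shift_mult) (simp add: poly_shift_def)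
qed

lemma L_monom: "L (monom 1 t) = g (Suc t)"
  by (simp add: L_def poly_shift_def degree_monom_eq sum.If_cases[where P = "\<lambda>j. j = t"] if_distrib[of "\<lambda>c. c * _"] cong: if_cong)

lemma L_monom_mult: "L (monom 1 t * q) = poly_shift q g (Suc t)"
  by (simp add: L_def poly_shift_mult poly_shift_def[of "monom 1 t"] degree_monom_eq
      if_distrib[of "\<lambda>c. c * _"] cong: if_cong)

text \<open>As in the proof of the Cauchy-Schwarz inequality, \<open>L (q * q) = 0\<close> forces
  \<open>L (p * q) = 0\<close> for all \<open>p\<close>. Monomials \<open>p\<close> then show that
  \<open>q\<close> annihilates \<open>g\<close>.\<close>

lemma L_square_pos:
  assumes "\<not> D dvd q" shows "0 < L (q * q)"
proof (rule ccontr)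
  assume "\<not> ?thesis"
  then have 0: "L (q * q) = 0" using nonneg(1)[of q] by (simp add: L_def)
  have "L (p * q) = 0" for p
  proof (rule quadratic_nonneg_imp_linear_zero)
    fix t :: real
    let ?s = "q + Polynomial.smult t p"
    have "?s * ?s = q * q + (Polynomial.smult t (p * q) + Polynomial.smult t (p * q)) +
        Polynomial.smult t (Polynomial.smult t (p * p))"
      by (simp add: algebra_simps)
    then have "L (?s * ?s) = t\<^sup>2 * L (p * p) + 2 * t * L (p * q)"
      by (simp only: L_add L_smult 0) (simp add: power2_eq_square algebra_simps)
    then show "0 \<le> t\<^sup>2 * L (p * p) + 2 * t * L (p * q)" using nonneg(1)[of ?s] by (simp add: L_def)
  qed
  then have "D dvd q" using L_monom_mult by (intro minimal) metis
  with assms show False by simp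
qed

section \<open>Roots of the denominator: real, nonnegative and simple\<close>

lemma not_D_dvd_cofactor:
  assumes "D = p * k" "0 < degree p" shows "\<not> D dvd k"
proof
  assume "D dvd k"
  moreover have "k \<noteq> 0" "p \<noteq> 0" using assms D_nonzero by auto
  ultimately have "degree D \<le> degree k" by (intro dvd_imp_degree_le)
  then show False using assms \<open>k \<noteq> 0\<close> \<open>p \<noteq> 0\<close> by (simp add: degree_mult_eq)
qed

text \<open>A nonreal root makes the real quadratic \<open>Q = l * l + (Im z)^2\<close> a factor,
  \<open>D = Q * k\<close>: the remainder has degree at most 1, real coefficients and a nonreal
  root, so it is zero. Then \<open>L (D * k) = 0\<close> is a sum of a nonnegative term and a
  positive multiple of \<open>L (k * k)\<close>.\<close>

lemma complex_root_real:
  assumes z: "poly (map_poly complex_of_real D) z = 0" shows "Im z = 0"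
proof (rule ccontr)
  assume Im: "Im z \<noteq> 0"
  interpret h: map_poly_inj_idom_hom complex_of_real ..
  define l where "l = [:- Re z, 1:]"
  define Q where "Q = l * l + [:(Im z)\<^sup>2:]"
  have Q: "Q = [:(Re z)\<^sup>2 + (Im z)\<^sup>2, - 2 * Re z, 1:]"
    by (simp add: Q_def l_def power2_eq_square)
  have Qz: "poly (map_poly complex_of_real Q) z = 0"
    by (simp add: Q map_poly_pCons complex_eq_iff power2_eq_square algebra_simps)
  define k where "k = D div Q"
  define m where "m = D mod Q"
  have D: "D = Q * k + m" unfolding k_def m_def by simp
  have "degree m < 2" using degree_mod_less[of Q D] unfolding m_def by (auto simp: Q)
  then have m: "m = [:coeff m 0, coeff m 1:]"
    by (intro poly_eqI) (auto simp: coeff_pCons coeff_eq_0 split: nat.splits)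
  have lin: "poly (map_poly complex_of_real [:a, b:]) z = complex_of_real a + z * complex_of_real b" for a b
    by (cases "b = 0"; cases "a = 0"; simp add: map_poly_pCons)
  have "poly (map_poly complex_of_real m) z = 0"
    using z Qz unfolding D by (simp add: h.hom_add h.hom_mult)
  then have "complex_of_real (coeff m 0) + z * complex_of_real (coeff m 1) = 0"
    unfolding lin[of "coeff m 0" "coeff m 1", folded m] .
  then have "coeff m 0 = 0" "coeff m 1 = 0" using Im by (auto simp: complex_eq_iff)
  then have "m = 0" using m by simp
  then have D: "D = Q * k" using D by simp
  have "degree Q = 2" by (simp add: Q)
  then have "0 < L (k * k)" using not_D_dvd_cofactor[OF D] L_square_pos by simp
  moreover have "Q * (k * k) = (l * k) * (l * k) + Polynomial.smult ((Im z)\<^sup>2) (k * k)"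
    by (simp add: Q_def algebra_simps)
  then have "L ((l * k) * (l * k)) + (Im z)\<^sup>2 * L (k * k) = L (D * k)"
    by (simp add: D L_add[symmetric] L_smult[symmetric] mult.assoc)
  then have "L ((l * k) * (l * k)) + (Im z)\<^sup>2 * L (k * k) = 0" by (simp add: L_dvd)
  moreover have "0 \<le> L ((l * k) * (l * k))" using nonneg(1) by (simp add: L_def)
  ultimately show False using Im by (smt (verit) mult_pos_pos zero_less_power2)
qed

text \<open>The cofactor \<open>k\<close> is the test polynomial. Modulo \<open>D\<close>,
  multiplying \<open>k\<close> by \<open>x\<close> is multiplying it by \<open>a\<close>, which
  gives the sign of \<open>a\<close>; if \<open>a\<close> were a double root, \<open>D\<close> would
  divide \<open>k * k\<close>.\<close>

lemma real_root:
  assumes D: "D = [:- a, 1:] * k" shows "0 \<le> a" "poly k a \<noteq> 0" "0 < L (k * k)"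
proof -
  have "degree [:- a, 1:] = 1" by simp
  then show pos: "0 < L (k * k)" using not_D_dvd_cofactor[OF D] L_square_pos by simp
  have "pCons 0 (k * k) = D * k + Polynomial.smult a (k * k)"
    unfolding D by (simp add: algebra_simps)
  then have "L (pCons 0 (k * k)) = a * L (k * k)" by (simp add: L_add L_smult L_dvd)
  moreover have "0 \<le> L (pCons 0 (k * k))" using nonneg(2) by (simp add: L_def)
  ultimately show "0 \<le> a" using pos by (simp add: zero_le_mult_iff)
  show "poly k a \<noteq> 0"
  proof
    assume "poly k a = 0"
    then obtain h where h: "k = [:- a, 1:] * h" unfolding poly_eq_0_iff_dvd by (rule dvdE)
    have "k * k = D * h" by (simp only: D h mult_ac)
    then show False using pos by (simp add: L_dvd)
  qed
qed

text \<open>All complex roots are real, and a multiple one would also be a root of its cofactor. The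
  complex form is proved first, since it counts poles with multiplicity, and is then pulled back
  along the embedding of the real polynomials.\<close>

lemma D_factorization:
  "D = Polynomial.smult (lead_coeff D) (\<Prod>a | poly D a = 0. [:- a, 1:])"
  "map_poly complex_of_real D =
    Polynomial.smult (complex_of_real (lead_coeff D)) (\<Prod>a | poly D a = 0. [:- complex_of_real a, 1:])"
proof -
  interpret h: map_poly_inj_idom_hom complex_of_real ..
  let ?D = "map_poly complex_of_real D"
  have root: "\<exists>a. z = complex_of_real a \<and> poly D a = 0" if "poly ?D z = 0" for z
  proof (intro exI[of _ "Re z"] conjI)
    show z: "z = complex_of_real (Re z)" using complex_root_real[OF that]
      by (simp add: complex_eq_iff)
    show "poly D (Re z) = 0"
      using that by (subst (asm) z) (simp add: map_poly_of_real_eval)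
  qed
  have "rsquarefree ?D"
    unfolding rsquarefree_roots
  proof (intro allI notI)
    fix z assume z: "poly ?D z = 0 \<and> poly (pderiv ?D) z = 0"
    then obtain a where a: "z = complex_of_real a" "poly D a = 0" using root by blast
    then obtain k where k: "D = [:- a, 1:] * k" unfolding poly_eq_0_iff_dvd by (metis dvdE)
    have "?D = [:- z, 1:] * map_poly complex_of_real k"
      by (subst k) (simp only: h.hom_mult, simp add: map_poly_pCons a)
    then have "poly (pderiv ?D) z = poly (map_poly complex_of_real k) z"
      by (simp only: pderiv_mult) (simp add: pderiv_pCons)
    then have "poly k a = 0" using z a(1) by (simp add: map_poly_of_real_eval)
    then show False using real_root(2)[OF k] by simp
  qed
  from complex_poly_decompose_rsquarefree[OF this]
  have "?D = Polynomial.smult (lead_coeff ?D) (\<Prod>z | poly ?D z = 0. [:- z, 1:])" by simp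
  also have "{z. poly ?D z = 0} = complex_of_real ` {a. poly D a = 0}"
    using root by (auto simp: map_poly_of_real_eval)
  also have "(\<Prod>z\<in>\<dots>. [:- z, 1:]) = (\<Prod>a | poly D a = 0. [:- complex_of_real a, 1:])"
    by (subst prod.reindex) (auto simp: inj_on_def)
  also have "lead_coeff ?D = complex_of_real (lead_coeff D)" by simp
  finally show D: "?D = Polynomial.smult (complex_of_real (lead_coeff D)) (\<Prod>a | poly D a = 0. [:- complex_of_real a, 1:])" .
  have "map_poly complex_of_real (Polynomial.smult (lead_coeff D) (\<Prod>a | poly D a = 0. [:- a, 1:])) = ?D"
    by (subst D) (simp add: map_poly_smult h.hom_prod map_poly_pCons)
  then show "D = Polynomial.smult (lead_coeff D) (\<Prod>a | poly D a = 0. [:- a, 1:])"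
    using h.injectivity by metis
qed

section \<open>Representation of the functional by positive point masses\<close>

lemma finite_roots: "finite {a. poly D a = 0}"
  using D_nonzero by (rule poly_roots_finite)

lemma D_dvd_if_roots:
  assumes "\<And>a. poly D a = 0 \<Longrightarrow> poly r a = 0" shows "D dvd r"
proof -
  have "(\<Prod>a\<in>P. [:- a, 1:]) dvd r" if "finite P" "\<forall>a\<in>P. poly r a = 0" for P :: "real set"
    using that
  proof (induction P)
    case (insert a P)
    then obtain s where s: "r = (\<Prod>a\<in>P. [:- a, 1:]) * s" by auto
    have "poly s a = 0" using insert by (auto simp: s poly_prod)
    then have "[:- a, 1:] dvd s" by (simp add: poly_eq_0_iff_dvd)
    then show ?case
      unfolding s prod.insert[OF insert(1,2)] by (metis mult.commute mult_dvd_mono dvd_refl)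
  qed simp
  then have "(\<Prod>a | poly D a = 0. [:- a, 1:]) dvd r" using finite_roots assms by simp
  then show ?thesis using D_nonzero by (subst D_factorization(1)) (simp add: smult_dvd_iff)
qed

text \<open>Modulo \<open>D\<close>, every \<open>f\<close> equals its Lagrange interpolant
  \<open>?I\<close> at the roots, whose basis polynomials are the cofactors \<open>k a\<close>
  scaled to value 1 at \<open>a\<close>. Positivity of a weight follows from evaluating
  \<open>L\<close> at \<open>k a * k a\<close>, which vanishes at all other roots.\<close>

lemma moment_representation:
  obtains w where "\<And>a. poly D a = 0 \<Longrightarrow> 0 \<le> a \<and> 0 < w a"
    "\<And>t. g (Suc t) = (\<Sum>a | poly D a = 0. w a * a ^ t)"
proof -
  have "\<exists>k. poly D a = 0 \<longrightarrow> D = [:- a, 1:] * k" for a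
    using poly_eq_0_iff_dvd[of D a] by (blast elim: dvdE)
  then obtain k where k: "\<And>a. poly D a = 0 \<Longrightarrow> D = [:- a, 1:] * k a" by metis
  define w where "w a = L (k a) / poly (k a) a" for a
  have ka: "poly (k a) b = 0" if "poly D a = 0" "poly D b = 0" "a \<noteq> b" for a b
  proof -
    have "poly ([:- a, 1:] * k a) b = 0" using k[OF that(1)] that(2) by simp
    then show ?thesis using that(3) by simp
  qed
  have L: "L f = (\<Sum>a | poly D a = 0. w a * poly f a)" for f
  proof -
    let ?I = "\<Sum>a | poly D a = 0. Polynomial.smult (poly f a / poly (k a) a) (k a)"
    have "poly (f - ?I) b = 0" if b: "poly D b = 0" for b
    proof -
      have "poly ?I b = (\<Sum>a | poly D a = 0. if a = b then poly f b else 0)"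
        unfolding poly_sum
      proof (rule sum.cong)
        fix a assume "a \<in> {a. poly D a = 0}"
        then show "poly (Polynomial.smult (poly f a / poly (k a) a) (k a)) b = (if a = b then poly f b else 0)"
          using ka[of a b] real_root(2)[OF k[of a]] b by auto
      qed simp
      also have "\<dots> = poly f b" using b finite_roots by simp
      finally show ?thesis by simp
    qed
    then have "L (f - ?I) = 0" by (intro L_dvd D_dvd_if_roots)
    then show ?thesis by (simp add: L_diff L_sum L_smult w_def mult.commute)
  qed
  have "0 \<le> a \<and> 0 < w a" if a: "poly D a = 0" for a
  proof
    show "0 \<le> a" using real_root(1)[OF k[OF a]] .
    have "L (k a * k a) = (\<Sum>b | poly D b = 0. if b = a then w a * (poly (k a) a)\<^sup>2 else 0)"
      unfolding L[of "k a * k a"] using ka[OF a]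
      by (intro sum.cong) (auto simp: power2_eq_square)
    also have "\<dots> = w a * (poly (k a) a)\<^sup>2" using a finite_roots by simp
    finally have "0 < w a * (poly (k a) a)\<^sup>2" using real_root(3)[OF k[OF a]] by simp
    then show "0 < w a" by (simp add: zero_less_mult_iff)
  qed
  moreover have "g (Suc t) = (\<Sum>a | poly D a = 0. w a * a ^ t)" for t
    using L[of "monom 1 t"] by (simp add: L_monom poly_monom)
  ultimately show ?thesis using that by blast
qed

end

text \<open>With the coefficients of \<open>q\<close> as test vector, the two positivity conditions
  are the Hankel forms with offset \<open>d = 0\<close> and \<open>d = 1\<close>.\<close>

lemma nonneg_moment_functional_denom:
  assumes G: "transfer_function G g" and H: "hankel_totally_positive g"
  shows "nonneg_moment_functional (denom G) g"
proof
  have psd: "0 \<le> poly_shift (q * q) g (Suc d)" for q d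
  proof -
    have "poly_shift (q * q) g (Suc d) = (\<Sum>i<Suc (degree q). \<Sum>j<Suc (degree q).
        g (Suc (i + j + d)) * coeff q i * coeff q j)"
      unfolding poly_shift_mult
      by (simp only: poly_shift_def lessThan_Suc_atMost sum_distrib_left) (simp add: mult_ac add_ac)
    then show ?thesis
      using hankel_totally_positive_nonneg[OF H, where N = "Suc (degree q)" and d = d and w = "coeff q"]
      by (simp only:)
  qed
  show "0 \<le> poly_shift (q * q) g 1" for q using psd[of q 0] by simp
  show "0 \<le> poly_shift (pCons 0 (q * q)) g 1" for q using psd[of q 1]
    by (simp add: poly_shift_pCons)
qed (use denom_nonzero transfer_function_denom[OF G] in auto)

section \<open>Diagonal realizations\<close>

lemma alternates_reindex:
  assumes "alternates D s m (\<lambda>i. F (p i))" and "\<And>i. i \<in> D \<Longrightarrow> p i \<in> E"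
    and "\<And>i j. i \<in> D \<Longrightarrow> j \<in> D \<Longrightarrow> i < j \<Longrightarrow> p i < p j"
  shows "alternates E s m F"
proof -
  obtain f where f: "\<forall>j\<le>m. f j \<in> D \<and> 0 < s * (-1) ^ j * F (p (f j))" "\<forall>j<m. f j < f (Suc j)"
    using assms(1) unfolding alternates_def by blast
  have "p (f j) < p (f (Suc j))" if "j < m" for j
    using f assms(3)[of "f j" "f (Suc j)"] that by auto
  then show ?thesis
    using f(1) assms(2) unfolding alternates_def by (intro exI[of _ "\<lambda>j. p (f j)"]) auto
qed

lemma dim_mat_diag [simp]: "dim_row (mat_diag n p) = n" "dim_col (mat_diag n p) = n"
  by (simp_all add: mat_diag_def)

lemma mat_diag_pow:
  fixes p :: "nat \<Rightarrow> 'a::comm_ring_1"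
  shows "mat_diag n p ^\<^sub>m k = mat_diag n (\<lambda>i. p i ^ k)"
proof (induction k)
  case 0
  show ?case by simp
next
  case (Suc k)
  then show ?case by (simp add: mat_diag_diag mult.commute)
qed

lemma mat_diag_mult_vec:
  assumes "v \<in> carrier_vec n" "i < n"
  shows "(mat_diag n p *\<^sub>v v) $ i = p i * v $ i"
proof -
  have "(mat_diag n p *\<^sub>v v) $ i = (\<Sum>j = 0..<n. (if i = j then p j else 0) * v $ j)"
    using assms by (simp add: mat_diag_def scalar_prod_def)
  also have "\<dots> = p i * v $ i"
    using assms(2) by (simp add: if_distrib[of "\<lambda>c. c * _"] cong: if_cong)
  finally show ?thesis .
qed

lemma char_poly_mat_diag: "char_poly (mat_diag n p) = (\<Prod>i<n. [:- p i, 1:])"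
proof -
  have "char_poly (mat_diag n p) = (\<Prod>a\<leftarrow>diag_mat (mat_diag n p). [:- a, 1:])"
    by (rule char_poly_upper_triangular[of _ n]) (auto simp: upper_triangular_def mat_diag_def)
  also have "diag_mat (mat_diag n p) = map p [0..<n]"
    by (auto simp: diag_mat_def mat_diag_def intro!: nth_equalityI)
  also have "(\<Prod>a\<leftarrow>map p [0..<n]. [:- a, 1:]) = (\<Prod>i<n. [:- p i, 1:])"
    by (simp add: comp_def prod.distinct_set_conv_list[symmetric] atLeast0LessThan)
  finally show ?thesis .
qed

lemma map_mat_mat_diag: "f 0 = 0 \<Longrightarrow> map_mat f (mat_diag n p) = mat_diag n (\<lambda>i. f (p i))"
  by (rule eq_matI) (auto simp: mat_diag_def)

lemma stable_mat_diag:
  assumes "\<And>i. i < n \<Longrightarrow> 0 \<le> p i \<and> p i < 1"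
  shows "stable (mat_diag n p)"
  unfolding stable_def
proof (intro allI impI)
  fix z assume "eigenvalue (map_mat complex_of_real (mat_diag n p)) z"
  then have "eigenvalue (mat_diag n (\<lambda>i. complex_of_real (p i))) z" by (simp add: map_mat_mat_diag)
  then have "poly (\<Prod>i<n. [:- complex_of_real (p i), 1:]) z = 0"
    by (subst (asm) eigenvalue_root_char_poly[of _ n]) (auto simp: char_poly_mat_diag)
  then obtain i where "i < n" "z = complex_of_real (p i)" by (auto simp: poly_prod)
  then show "cmod z < 1" using assms by simp
qed

lemma observability_op_mat_diag:
  assumes "x \<in> carrier_vec n" "c \<in> carrier_vec n"
  shows "observability_op (mat_diag n p) c x t = (\<Sum>i<n. c $ i * x $ i * p i ^ t)"
proof -
  have "mat_diag n (\<lambda>i. p i ^ t) *\<^sub>v x \<in> carrier_vec n"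
    using mat_diag_dim by (rule mult_mat_vec_carrier) (rule assms(1))
  then have "observability_op (mat_diag n p) c x t =
      (\<Sum>i<n. c $ i * (mat_diag n (\<lambda>i. p i ^ t) *\<^sub>v x) $ i)"
    by (simp add: observability_op_def mat_diag_pow scalar_prod_def atLeast0LessThan del: index_mult_mat_vec)
  also have "\<dots> = (\<Sum>i<n. c $ i * x $ i * p i ^ t)"
    using assms
    by (intro sum.cong) (auto simp: mat_diag_mult_vec[where n = n] simp del: index_mult_mat_vec)
  finally show ?thesis .
qed

lemma controllability_op_mat_diag:
  assumes "i < n"
  shows "controllability_op n (mat_diag n p) (vec n (\<lambda>_. 1)) u $ i = (\<Sum>k. past_entries u k * p i ^ k)"
  unfolding controllability_op_def past_entries_def using assms
  by (simp add: mat_diag_pow mat_diag_mult_vec[where n = n] mult.commute del: index_mult_mat_vec)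

section \<open>Internal total positivity of the diagonal realization\<close>

lemma past_inputs_summable:
  assumes "u \<in> past_inputs" "0 < x" "x < 1"
  shows "summable (\<lambda>k. past_entries u k * x ^ k)"
proof -
  obtain B where B: "\<And>k. \<bar>past_entries u k\<bar> \<le> B"
    using assms(1) unfolding past_inputs_def Bseq_def by auto
  have "summable (\<lambda>k. B * x ^ k)" using assms by (intro summable_mult summable_geometric) simp
  then show ?thesis
    by (rule summable_comparison_test'[of _ 0]) (use B assms in \<open>auto simp: abs_mult intro!: mult_right_mono\<close>)
qed

text \<open>Chains are pulled back through each map. The state matrix scales entries by nonnegative
  numbers, so a zero pole at most deletes an entry. The observability operator gives an exponential
  sum whose coefficients have the signs of \<open>x\<close>, and the controllability operator
  samples at the increasing nodes the power series with coefficients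
  \<open>u(-1), u(-2), ...\<close>.\<close>

lemma internally_hankel_totally_positive_mat_diag:
  assumes p: "\<And>i. i < n \<Longrightarrow> 0 \<le> p i \<and> p i < 1" "\<And>i j. i < j \<Longrightarrow> j < n \<Longrightarrow> p i < p j"
    and c: "c \<in> carrier_vec n" "\<And>i. i < n \<Longrightarrow> 0 < c $ i"
  shows "internally_hankel_totally_positive n (mat_diag n p) (vec n (\<lambda>_. 1)) c"
  unfolding internally_hankel_totally_positive_def
proof (intro allI impI conjI; rule OVD_if_alternates)
  fix s :: real and m and x :: "real vec"
  assume x: "x \<in> carrier_vec n"
  show "alternates UNIV s m (vec_entries x)"
    if "alternates UNIV s m (vec_entries (mat_diag n p *\<^sub>v x))"
    using that
  proof (rule alternates_mono)
    fix i
    have *: "vec_entries (mat_diag n p *\<^sub>v x) i = (if i < n then p i * vec_entries x i else 0)"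
      using x mat_diag_mult_vec[OF x, of i p]
      by (auto simp: vec_entries_def simp del: index_mult_mat_vec)
    show "i \<in> UNIV \<and> 0 < vec_entries x i" if "0 < vec_entries (mat_diag n p *\<^sub>v x) i"
      using that p(1)[of i] unfolding * by (auto simp: zero_less_mult_iff split: if_splits)
    show "i \<in> UNIV \<and> vec_entries x i < 0" if "vec_entries (mat_diag n p *\<^sub>v x) i < 0"
      using that p(1)[of i] unfolding * by (auto simp: mult_less_0_iff split: if_splits)
  qed
  show "alternates UNIV s m (vec_entries x)"
    if "alternates UNIV s m (observability_op (mat_diag n p) c x)"
  proof -
    let ?y = "\<lambda>i. if i < n then c $ i * x $ i else 0"
    have "observability_op (mat_diag n p) c x = (\<lambda>t. \<Sum>i<n. ?y i * p i ^ t)"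
      using x c(1) by (auto simp: observability_op_mat_diag)
    then have "alternates UNIV s m (\<lambda>t. \<Sum>i<n. ?y i * p i ^ t)" using that by simp
    then have "alternates UNIV s m ?y"
      by (rule exponential_sum_alternates[rotated 3]) (use p in auto)
    then show ?thesis
    proof (rule alternates_mono)
      fix i
      show "i \<in> UNIV \<and> 0 < vec_entries x i" if "0 < ?y i"
        using that c(2)[of i] x by (auto simp: zero_less_mult_iff vec_entries_def split: if_splits)
      show "i \<in> UNIV \<and> vec_entries x i < 0" if "?y i < 0"
        using that c(2)[of i] x by (auto simp: mult_less_0_iff vec_entries_def split: if_splits)
    qed
  qed
next
  fix s :: real and m u
  assume u: "u \<in> past_inputs"
    and alt: "alternates UNIV s m (vec_entries (controllability_op n (mat_diag n p) (vec n (\<lambda>_. 1)) u))"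
  let ?F = "\<lambda>x. \<Sum>k. past_entries u k * x ^ k"
  have *: "vec_entries (controllability_op n (mat_diag n p) (vec n (\<lambda>_. 1)) u) i =
      (if i < n then ?F (p i) else 0)" for i
  proof (cases "i < n")
    case True
    then show ?thesis using controllability_op_mat_diag[OF True]
      by (simp add: vec_entries_def) (simp add: controllability_op_def)
  qed (simp add: vec_entries_def controllability_op_def)
  have "alternates {..<n} s m (\<lambda>i. ?F (p i))"
    by (rule alternates_mono[OF alt]) (auto simp: * split: if_splits)
  then have "alternates {0..<1} s m ?F"
    by (rule alternates_reindex) (use p in auto)
  then show "alternates UNIV s m (past_entries u)"
    by (rule power_series_alternates[rotated]) (use past_inputs_summable[OF u] in auto)
qed

lemma internal_realization_if_hankel_totally_positive:
  assumes G: "transfer_function G g" and H: "hankel_totally_positive g"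
  shows "\<exists>n A b c. minimal_realization n A b c G g \<and> internally_hankel_totally_positive n A b c"
proof -
  interpret nonneg_moment_functional "denom G" g
    using nonneg_moment_functional_denom[OF G H] .
  let ?P = "{a. poly (denom G) a = 0}"
  obtain w where w: "\<And>a. a \<in> ?P \<Longrightarrow> 0 \<le> a \<and> 0 < w a" and g: "\<And>t. g (Suc t) = (\<Sum>a\<in>?P. w a * a ^ t)"
  proof (rule moment_representation)
    fix w assume "\<And>a. poly (denom G) a = 0 \<Longrightarrow> 0 \<le> a \<and> 0 < w a"
      and "\<And>t. g (Suc t) = (\<Sum>a\<in>?P. w a * a ^ t)"
    then show thesis by (intro that[of w]) auto
  qed
  \<comment> \<open>All terms of \<open>g\<close> are nonnegative, so a pole at or beyond
    \<open>1\<close> would keep \<open>g\<close> above the positive weight \<open>w a\<close>,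
    contradicting summability.\<close>
  have lt1: "a < 1" if a: "a \<in> ?P" for a
  proof (rule ccontr)
    assume "\<not> a < 1"
    then have "w a \<le> g (Suc t)" for t
    proof -
      have "w a * 1 \<le> w a * a ^ t"
        using w[OF a] \<open>\<not> a < 1\<close> by (intro mult_left_mono one_le_power) auto
      also have "\<dots> \<le> g (Suc t)" unfolding g
      proof (rule member_le_sum[OF a _ finite_roots])
        show "0 \<le> w b * b ^ t" if "b \<in> ?P - {a}" for b
          using w[of b] that by (intro mult_nonneg_nonneg zero_le_power) (auto simp: less_imp_le)
      qed
      finally show ?thesis by simp
    qed
    moreover have "summable g"
      using G unfolding transfer_function_def by (auto intro: summable_rabs_cancel)
    then have "(\<lambda>t. g (Suc t)) \<longlonglongrightarrow> 0" by (intro LIMSEQ_Suc summable_LIMSEQ_zero)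
    ultimately have "w a \<le> 0" by (intro LIMSEQ_le_const) auto
    then show False using w[OF a] by simp
  qed
  \<comment> \<open>Both sign rules require the nodes to increase with the state index.\<close>
  define xs where "xs = sorted_list_of_set ?P"
  define n where "n = length xs"
  define p where "p i = xs ! i" for i
  have bij: "bij_betw p {..<n} ?P"
    using bij_betw_nth[of xs "{..<n}" ?P] finite_roots unfolding p_def n_def xs_def by simp
  have pP: "p i \<in> ?P" if "i < n" for i using bij_betwE[OF bij] that by simp
  have p01: "0 \<le> p i \<and> p i < 1" if "i < n" for i using w[OF pP[OF that]] lt1[OF pP[OF that]] by simp
  have p_less: "p i < p j" if "i < j" "j < n" for i j
    using strict_sorted_list_of_set[of ?P] that unfolding p_def n_def xs_def
    by (rule sorted_wrt_nth_less)
  define c where "c = vec n (\<lambda>i. w (p i))"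
  have c: "c \<in> carrier_vec n" "\<And>i. i < n \<Longrightarrow> c $ i = w (p i)" unfolding c_def by auto
  have "realization n (mat_diag n p) (vec n (\<lambda>_. 1)) c g"
    unfolding realization_def
  proof (intro conjI allI impI)
    show "stable (mat_diag n p)" using p01 by (rule stable_mat_diag)
    fix t :: nat assume "1 \<le> t"
    then have "g t = (\<Sum>a\<in>?P. w a * a ^ (t - 1))" using g[of "t - 1"] by simp
    also have "\<dots> = (\<Sum>i<n. w (p i) * p i ^ (t - 1))"
      using sum.reindex_bij_betw[OF bij, of "\<lambda>a. w a * a ^ (t - 1)"] by simp
    also have "\<dots> = c \<bullet> (mat_diag n p ^\<^sub>m (t - 1) *\<^sub>v vec n (\<lambda>_. 1))"
      using observability_op_mat_diag[of "vec n (\<lambda>_. 1)" n c p "t - 1"] c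
      by (simp add: observability_op_def)
    finally show "g t = c \<bullet> (mat_diag n p ^\<^sub>m (t - 1) *\<^sub>v vec n (\<lambda>_. 1))" .
  qed (use c in auto)
  moreover have "order z (char_poly (map_mat complex_of_real (mat_diag n p))) = pole_order G z" for z
  proof -
    have "char_poly (map_mat complex_of_real (mat_diag n p)) = (\<Prod>i<n. [:- complex_of_real (p i), 1:])"
      by (simp add: map_mat_mat_diag char_poly_mat_diag)
    also have "\<dots> = (\<Prod>a\<in>?P. [:- complex_of_real a, 1:])"
      using prod.reindex_bij_betw[OF bij, of "\<lambda>a. [:- complex_of_real a, 1:]"] .
    finally show ?thesis
      unfolding pole_order_def D_factorization(2) using D_nonzero by (simp add: order_smult)
  qed
  ultimately have "minimal_realization n (mat_diag n p) (vec n (\<lambda>_. 1)) c G g"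
    unfolding minimal_realization_def by blast
  moreover have "internally_hankel_totally_positive n (mat_diag n p) (vec n (\<lambda>_. 1)) c"
    using p01 p_less c w[OF pP] by (intro internally_hankel_totally_positive_mat_diag) auto
  ultimately show ?thesis by blast
qed

section \<open>Factorization of the Hankel operator\<close>

lemma smult_mat_pow:
  fixes A :: "'a::comm_ring_1 mat"
  assumes A: "A \<in> carrier_mat n n"
  shows "(s \<cdot>\<^sub>m A) ^\<^sub>m k = s ^ k \<cdot>\<^sub>m A ^\<^sub>m k"
proof (induction k)
  case 0
  show ?case using A by (intro eq_matI) auto
next
  case (Suc k)
  have Ak: "A ^\<^sub>m k \<in> carrier_mat n n" using A by simp
  have sA: "s \<cdot>\<^sub>m A \<in> carrier_mat n n" using A by simp
  have "(s ^ k \<cdot>\<^sub>m A ^\<^sub>m k) * (s \<cdot>\<^sub>m A) = s ^ k \<cdot>\<^sub>m (s \<cdot>\<^sub>m (A ^\<^sub>m k * A))"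
    unfolding mult_smult_assoc_mat[OF Ak sA] mult_smult_distrib[OF Ak A] ..
  also have "\<dots> = s ^ Suc k \<cdot>\<^sub>m (A ^\<^sub>m k * A)" by (rule eq_matI) (auto simp: mult_ac)
  finally show ?case by (simp add: Suc)
qed

text \<open>For \<open>r\<close> strictly between the spectral radius and 1, the rescaled matrix
  \<open>A / r\<close> still has spectral radius below 1, so its powers are bounded. Dimension
  \<open>0\<close> is split off because the spectrum is empty there.\<close>

lemma stable_power_bound:
  assumes A: "A \<in> carrier_mat n n" and stable: "stable A"
  shows "\<exists>C r. 0 < r \<and> r < 1 \<and> (\<forall>k. \<forall>i<n. \<forall>j<n. \<bar>(A ^\<^sub>m k) $$ (i, j)\<bar> \<le> C * r ^ k)"
proof (cases "n = 0")
  case True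
  then show ?thesis by (intro exI[of _ 0] exI[of _ "1/2"]) simp
next
  case False
  define B where "B = map_mat complex_of_real A"
  have B: "B \<in> carrier_mat n n" using A unfolding B_def by simp
  define \<rho> where "\<rho> = spectral_radius B"
  have "\<rho> \<in> cmod ` spectrum B"
    unfolding \<rho>_def by (rule spectral_radius_mem_max(1)[OF B]) (use False in simp)
  then have \<rho>: "0 \<le> \<rho>" "\<rho> < 1"
    using stable unfolding stable_def B_def[symmetric] spectrum_def by auto
  define r where "r = (1 + \<rho>) / 2"
  have r: "0 < r" "r < 1" "\<rho> < r" using \<rho> unfolding r_def by auto
  define E where "E = complex_of_real (1 / r) \<cdot>\<^sub>m B"
  have E: "E \<in> carrier_mat n n" using B unfolding E_def by simp
  have "cmod z < 1" if z: "z \<in> spectrum E" for z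
  proof -
    obtain v where v: "v \<in> carrier_vec n" "v \<noteq> 0\<^sub>v n" "E *\<^sub>v v = z \<cdot>\<^sub>v v"
      using z E unfolding spectrum_def eigenvalue_def eigenvector_def by auto
    have "B *\<^sub>v v = (of_real r * z) \<cdot>\<^sub>v v"
    proof (rule eq_vecI)
      fix i assume "i < dim_vec ((of_real r * z) \<cdot>\<^sub>v v)"
      then have i: "i < n" using v by simp
      have "(E *\<^sub>v v) $ i = z * v $ i" using v i by simp
      moreover have "(E *\<^sub>v v) $ i = complex_of_real (1 / r) * (B *\<^sub>v v) $ i"
        using i B v(1) unfolding E_def by (simp add: scalar_prod_def sum_distrib_left mult.assoc)
      ultimately have "complex_of_real (1 / r) * (B *\<^sub>v v) $ i = z * v $ i" by simp
      then have "(B *\<^sub>v v) $ i = of_real r * (z * v $ i)" using r(1) by (simp add: field_simps)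
      then show "(B *\<^sub>v v) $ i = ((of_real r * z) \<cdot>\<^sub>v v) $ i" using i v by (simp add: mult.assoc)
    qed (use v B in simp)
    then have "of_real r * z \<in> spectrum B"
      using v B unfolding spectrum_def eigenvalue_def eigenvector_def by auto
    then have "cmod (of_real r * z) \<le> \<rho>"
      unfolding \<rho>_def using spectral_radius_mem_max(2)[OF B] False by blast
    then have "r * cmod z \<le> \<rho>" using r(1) by (simp add: norm_mult)
    then have "r * cmod z < r * 1" using r(3) by linarith
    then show ?thesis using r(1) by (simp only: mult_less_cancel_left_pos)
  qed
  then have "spectral_radius E < 1"
    using spectral_radius_mem_max(1)[OF E] False by auto
  then obtain C where C: "\<And>k. norm_bound (E ^\<^sub>m k) C"
    using spectral_radius_jnf_norm_bound_less_1_upper_triangular[OF E] by blast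
  have "\<bar>(A ^\<^sub>m k) $$ (i, j)\<bar> \<le> C * r ^ k" if ij: "i < n" "j < n" for k i j
  proof -
    have Bk: "B ^\<^sub>m k = map_mat complex_of_real (A ^\<^sub>m k)"
      unfolding B_def by (rule of_real_hom.mat_hom_pow[OF A, symmetric])
    have "(E ^\<^sub>m k) $$ (i, j) = complex_of_real ((1 / r) ^ k * (A ^\<^sub>m k) $$ (i, j))"
      using ij A unfolding E_def smult_mat_pow[OF B] Bk by simp
    then have "cmod ((E ^\<^sub>m k) $$ (i, j)) = (1 / r) ^ k * \<bar>(A ^\<^sub>m k) $$ (i, j)\<bar>"
      using r(1) by (simp add: norm_mult norm_divide norm_power)
    moreover have "E ^\<^sub>m k \<in> carrier_mat n n" using E by simp
    then have "cmod ((E ^\<^sub>m k) $$ (i, j)) \<le> C" 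
      using C[of k] ij unfolding norm_bound_def by (metis carrier_matD)
    ultimately have "\<bar>(A ^\<^sub>m k) $$ (i, j)\<bar> / r ^ k \<le> C" by (simp add: power_one_over)
    then show ?thesis using r(1) by (simp add: pos_divide_le_eq)
  qed
  then show ?thesis using r(1,2) by (intro exI[of _ C] exI[of _ r]) simp
qed

lemma pow_mat_add_mult_vec:
  assumes A: "A \<in> carrier_mat n n" and b: "b \<in> carrier_vec n"
  shows "A ^\<^sub>m (t + k) *\<^sub>v b = A ^\<^sub>m t *\<^sub>v (A ^\<^sub>m k *\<^sub>v (b :: 'a::comm_ring_1 vec))"
  using b
proof (induction k arbitrary: b)
  case 0
  then show ?case using A by simp
next
  case (Suc k)
  have pow: "A ^\<^sub>m m \<in> carrier_mat n n" for m using A by simp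
  have "A ^\<^sub>m (t + Suc k) *\<^sub>v b = A ^\<^sub>m (t + k) *\<^sub>v (A *\<^sub>v b)"
    using assoc_mult_mat_vec[OF pow A Suc.prems] by simp
  also have "\<dots> = A ^\<^sub>m t *\<^sub>v (A ^\<^sub>m k *\<^sub>v (A *\<^sub>v b))"
    using A Suc.prems by (intro Suc.IH) simp
  also have "A ^\<^sub>m k *\<^sub>v (A *\<^sub>v b) = A ^\<^sub>m Suc k *\<^sub>v b"
    using assoc_mult_mat_vec[OF pow A Suc.prems, of k] by simp
  finally show ?case .
qed

lemma summable_controllability:
  assumes A: "A \<in> carrier_mat n n" and b: "b \<in> carrier_vec n" and "stable A"
    and u: "u \<in> past_inputs" and i: "i < n"
  shows "summable (\<lambda>k. (A ^\<^sub>m k *\<^sub>v b) $ i * u (- int (Suc k)))"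
proof -
  obtain B where B: "\<And>k. \<bar>u (- int (Suc k))\<bar> \<le> B"
    using u unfolding past_inputs_def Bseq_def past_entries_def by auto
  obtain C r where r: "0 < r" "r < 1" and C: "\<forall>k. \<forall>i<n. \<forall>j<n. \<bar>(A ^\<^sub>m k) $$ (i, j)\<bar> \<le> C * r ^ k"
    using stable_power_bound[OF A \<open>stable A\<close>] by (elim exE conjE)
  define K where "K = (\<Sum>j<n. C * \<bar>b $ j\<bar>)"
  have Ab: "\<bar>(A ^\<^sub>m k *\<^sub>v b) $ i\<bar> \<le> K * r ^ k" for k
  proof -
    have "(M *\<^sub>v b) $ i = (\<Sum>j<n. M $$ (i, j) * b $ j)" if "M \<in> carrier_mat n n" for M
      using that i b by (auto simp: scalar_prod_def atLeast0LessThan)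
    then have "(A ^\<^sub>m k *\<^sub>v b) $ i = (\<Sum>j<n. (A ^\<^sub>m k) $$ (i, j) * b $ j)"
      using pow_carrier_mat[OF A] by blast
    also have "\<bar>\<dots>\<bar> \<le> (\<Sum>j<n. \<bar>(A ^\<^sub>m k) $$ (i, j) * b $ j\<bar>)" by (rule sum_abs)
    also have "\<dots> \<le> (\<Sum>j<n. C * r ^ k * \<bar>b $ j\<bar>)"
      unfolding abs_mult using C i by (intro sum_mono mult_right_mono) auto
    also have "\<dots> = K * r ^ k" unfolding K_def
      by (simp add: sum_distrib_left sum_distrib_right mult_ac)
    finally show ?thesis .
  qed
  have "summable (\<lambda>k. K * r ^ k * B)"
    using r by (intro summable_mult2 summable_mult summable_geometric) simp
  then show ?thesis
  proof (rule summable_comparison_test'[of _ 0])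
    fix k
    have "\<bar>(A ^\<^sub>m k *\<^sub>v b) $ i\<bar> * \<bar>u (- int (Suc k))\<bar> \<le> K * r ^ k * B"
      using Ab[of k] B[of k] by (intro mult_mono) (auto intro: order_trans[OF abs_ge_zero])
    then show "norm ((A ^\<^sub>m k *\<^sub>v b) $ i * u (- int (Suc k))) \<le> K * r ^ k * B"
      by (simp add: abs_mult)
  qed
qed

text \<open>The identity \<open>c A^(t+k) b = (c A^t) (A^k b)\<close> separates future from past. It
  remains to exchange the series over \<open>k\<close> with the finite sum over the state
  coordinates.\<close>

lemma hankel_op_eq_observability_controllability:
  assumes R: "realization n A b c g" and u: "u \<in> past_inputs"
  shows "hankel_op g u = observability_op A c (controllability_op n A b u)"
proof
  fix t
  have A: "A \<in> carrier_mat n n" and b: "b \<in> carrier_vec n" and c: "c \<in> carrier_vec n"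
    and st: "stable A" and g: "\<And>t. 1 \<le> t \<Longrightarrow> g t = c \<bullet> (A ^\<^sub>m (t - 1) *\<^sub>v b)"
    using R unfolding realization_def by auto
  have pow: "A ^\<^sub>m m \<in> carrier_mat n n" for m using A by simp
  \<comment> \<open>The transposed row vector \<open>c A^t\<close>: the output at time
    \<open>t\<close> becomes a fixed finite linear combination of state coordinates.\<close>
  define d where "d = transpose_mat (A ^\<^sub>m t) *\<^sub>v c"
  have obs: "c \<bullet> (A ^\<^sub>m t *\<^sub>v x) = (\<Sum>i<n. d $ i * x $ i)" if x: "x \<in> carrier_vec n" for x
    using transpose_vec_mult_scalar[OF pow x c, of t, symmetric] x
    unfolding d_def[symmetric] by (simp add: scalar_prod_def atLeast0LessThan)
  let ?x = "\<lambda>k. A ^\<^sub>m k *\<^sub>v b" and ?u = "\<lambda>k. u (- int (Suc k))"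
  have x: "?x k \<in> carrier_vec n" for k using pow b by (rule mult_mat_vec_carrier)
  have "g (t + Suc k) * ?u k = (\<Sum>i<n. d $ i * (?x k $ i * ?u k))" for k
  proof -
    have "g (t + Suc k) = c \<bullet> (A ^\<^sub>m t *\<^sub>v ?x k)"
      using g[of "t + Suc k"] pow_mat_add_mult_vec[OF A b, of t k] by simp
    also have "\<dots> = (\<Sum>i<n. d $ i * ?x k $ i)" by (rule obs[OF x])
    finally show ?thesis by (simp add: sum_distrib_right mult.assoc)
  qed
  then have "hankel_op g u t = (\<Sum>k. \<Sum>i<n. d $ i * (?x k $ i * ?u k))"
    unfolding hankel_op_def by simp
  also have "\<dots> = (\<Sum>i<n. \<Sum>k. d $ i * (?x k $ i * ?u k))"
    using summable_controllability[OF A b st u] by (intro suminf_sum summable_mult) auto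
  also have "\<dots> = (\<Sum>i<n. d $ i * controllability_op n A b u $ i)"
    using summable_controllability[OF A b st u]
    by (intro sum.cong) (auto simp: controllability_op_def suminf_mult simp del: index_mult_mat_vec)
  also have "\<dots> = observability_op A c (controllability_op n A b u) t"
    unfolding observability_op_def by (rule obs[symmetric]) (simp add: controllability_op_def)
  finally show "hankel_op g u t = observability_op A c (controllability_op n A b u) t" .
qed

text \<open>Equality of the outer variations forces equality at both stages, so the two sign clauses
  can be chained. The assumption \<open>zero\<close> ensures that the intermediate value is nonzero,
  as otherwise these clauses would be void.\<close>

lemma OVD_compose:
  assumes X: "OVD \<sigma> \<tau> U m X" and Y: "OVD \<tau> \<rho> V m Y" and UV: "\<And>u. u \<in> U \<Longrightarrow> X u \<in> V"
    and zero: "\<And>u. u \<in> U \<Longrightarrow> \<exists>i. \<rho> (Y (X u)) i \<noteq> 0 \<Longrightarrow> \<exists>i. \<tau> (X u) i \<noteq> 0"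
    and Z: "\<And>u. u \<in> U \<Longrightarrow> Z u = Y (X u)"
  shows "OVD \<sigma> \<rho> U m Z"
  unfolding OVD_def
proof (intro ballI impI conjI)
  fix u assume u: "u \<in> U" and m: "variation (\<sigma> u) \<le> enat m"
  have 1: "variation (\<tau> (X u)) \<le> variation (\<sigma> u)" using X u m unfolding OVD_def by blast
  then have 2: "variation (\<rho> (Z u)) \<le> variation (\<tau> (X u))"
    using Y UV[OF u] Z[OF u] m unfolding OVD_def by (metis order_trans)
  show "variation (\<rho> (Z u)) \<le> variation (\<sigma> u)" using 1 2 by (rule order_trans[rotated])
  assume eq: "variation (\<rho> (Z u)) = variation (\<sigma> u) \<and> (\<exists>i. \<sigma> u i \<noteq> 0) \<and> (\<exists>i. \<rho> (Z u) i \<noteq> 0)"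
  then have eqs: "variation (\<tau> (X u)) = variation (\<sigma> u)" "variation (\<rho> (Z u)) = variation (\<tau> (X u))"
    using 1 2 by auto
  have nz: "\<exists>i. \<tau> (X u) i \<noteq> 0" using zero[OF u] eq Z[OF u] by simp
  have "sgn (first_nonzero (\<sigma> u)) = sgn (first_nonzero (\<tau> (X u)))"
    using X u m eq eqs(1) nz unfolding OVD_def by blast
  also have "\<dots> = sgn (first_nonzero (\<rho> (Z u)))"
    using Y UV[OF u] m eq eqs nz Z[OF u] unfolding OVD_def by metis
  finally show "sgn (first_nonzero (\<sigma> u)) = sgn (first_nonzero (\<rho> (Z u)))" .
qed

lemma hankel_totally_positive_if_internally:
  assumes R: "realization n A b c g" and I: "internally_hankel_totally_positive n A b c"
  shows "hankel_totally_positive g"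
  unfolding hankel_totally_positive_def
proof (intro allI impI)
  fix k :: nat assume k: "1 \<le> k"
  have A: "A \<in> carrier_mat n n" and c: "c \<in> carrier_vec n" using R unfolding realization_def by auto
  show "OVD past_entries (\<lambda>y. y) past_inputs (k - 1) (hankel_op g)"
  proof (rule OVD_compose)
    show "OVD past_entries vec_entries past_inputs (k - 1) (controllability_op n A b)"
      "OVD vec_entries (\<lambda>y. y) (carrier_vec n) (k - 1) (observability_op A c)"
      using I k unfolding internally_hankel_totally_positive_def by blast+
    show "hankel_op g u = observability_op A c (controllability_op n A b u)"
      if "u \<in> past_inputs" for u
      using R that by (rule hankel_op_eq_observability_controllability)
    show "controllability_op n A b u \<in> carrier_vec n" for u by (simp add: controllability_op_def)
    show "\<exists>i. vec_entries (controllability_op n A b u) i \<noteq> 0"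
      if nz: "\<exists>i. observability_op A c (controllability_op n A b u) i \<noteq> 0" for u
    proof (rule ccontr)
      assume zero: "\<not> ?thesis"
      let ?x = "controllability_op n A b u"
      have "?x = 0\<^sub>v n"
      proof (rule eq_vecI)
        fix i assume "i < dim_vec (0\<^sub>v n :: real vec)"
        then have "vec_entries ?x i = ?x $ i" by (simp add: vec_entries_def controllability_op_def)
        then show "?x $ i = 0\<^sub>v n $ i" using zero \<open>i < _\<close> by simp
      qed (simp add: controllability_op_def)
      moreover have "A ^\<^sub>m t *\<^sub>v 0\<^sub>v n = 0\<^sub>v n" for t
        using A by (intro eq_vecI) auto
      ultimately have "observability_op A c ?x t = 0" for t
        using c by (simp add: observability_op_def)
      then show False using nz by simp
    qed
  qed
qed

theorem proposition3p3:
  fixes G :: "real poly fract" and g :: "nat \<Rightarrow> real"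
  assumes "transfer_function G g"
  shows "hankel_totally_positive g \<longleftrightarrow>
    (\<exists>n A b c. minimal_realization n A b c G g \<and> internally_hankel_totally_positive n A b c)"
  using internal_realization_if_hankel_totally_positive[OF assms]
    hankel_totally_positive_if_internally
  unfolding minimal_realization_def by blast

end
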